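(* Let $T,\nu_1,\nu_2$ be positive real numbers with $\nu_1\le\nu_2$. For every positive integer $k$ there exist constants $\varepsilon_k>0$ and $C_k>0$, depending only on $k,T,\nu_1,\nu_2$, such that for every measurable function $c:(0,T)\to\mathbb R$ satisfying $\nu_1\le c(t)\le\nu_2$ for almost every $t\in(0,T)$ one has $$\mathcal G(c,\lambda,T)\le C_k\left(1+\mathcal M_k^*\left((0,T),\frac1c,\lambda\right)\right)\qquad\forall\lambda>0,$$ where the constrained minimum value $\mathcal M_k^*$ is defined with range constraints $\mu_1:=1/\nu_2$, $\mu_2:=1/\nu_1$ and with the constant $\varepsilon_k$ in the derivative constraints.
   Context: Growth function: for $\lambda>0$ consider solutions $u_\lambda$ on $[0,T]$ of $u_\lambda''+\lambda^2c(t)^2u_\lambda=0$ (i.e. $u_\lambda\in C^1([0,T])$, $u_\lambda'$ absolutely continuous, equation satisfied almost everywhere), with energy $E_\lambda(t):=u_\lambda'(t)^2+\lambda^2u_\lambda(t)^2$. Then $$\mathcal G(c,\lambda,T):=\log\left(\sup\{E_\lambda(t):u_\lambda\text{ solution},\ E_\lambda(0)\le1,\ t\in[0,T]\}\right).$$ Constrained minimum: for $g\in L^1((0,T))$ with $\mu_1\le g\le\mu_2$ a.e., let $\mathcal D_{k,\lambda}$ be the class of all $\gamma\in C^k([0,T])$ such that $\mu_1\le\gamma(x)\le\mu_2$ for every $x\in[0,T]$ and, if $k\ge2$, $|\gamma^{(j)}(x)|\le\varepsilon_k\lambda^j$ for every $x\in[0,T]$ and every $j\in\{1,\dots,k-1\}$.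 Then $$\mathcal M_k^*((0,T),g,\lambda):=\inf_{\gamma\in\mathcal D_{k,\lambda}}\left\{\frac1{\lambda^{k-1}}\int_0^T|\gamma^{(k)}(x)|\,dx+\lambda\int_0^T|\gamma(x)-g(x)|\,dx\right\}.$$ *)

theory Defs
  imports "HOL-Analysis.Analysis"
begin

text \<open>
  Derivatives are taken within the set \<open>S\<close>, hence are one-sided at the endpoints of
  \<open>S = {0..T}\<close>.  For points of \<open>S\<close> they depend only on the values of \<open>f\<close> on \<open>S\<close>.
\<close>

definition deriv_on :: "real set \<Rightarrow> (real \<Rightarrow> real) \<Rightarrow> real \<Rightarrow> real" where
  "deriv_on S f = (\<lambda>x. vector_derivative f (at x within S))"

definition higher_deriv_on :: "real set \<Rightarrow> nat \<Rightarrow> (real \<Rightarrow> real) \<Rightarrow> real \<Rightarrow> real" where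
  "higher_deriv_on S j f = (deriv_on S ^^ j) f"

definition Ck_on :: "nat \<Rightarrow> (real \<Rightarrow> real) \<Rightarrow> real set \<Rightarrow> bool" where
  "Ck_on k f S \<longleftrightarrow>
     (\<forall>j<k. higher_deriv_on S j f differentiable_on S) \<and>
     continuous_on S (higher_deriv_on S k f)"

text \<open>
  Pairs in \<open>I\<close> are the endpoints of finitely many non-overlapping subintervals of \<open>[a,b]\<close>.
\<close>

definition abs_continuous_on_interval :: "real \<Rightarrow> real \<Rightarrow> (real \<Rightarrow> real) \<Rightarrow> bool" where
  "abs_continuous_on_interval a b f \<longleftrightarrow>
     (\<forall>e>0. \<exists>d>0. \<forall>I :: (real \<times> real) set.
        finite I \<and>
        (\<forall>(x, y)\<in>I. a \<le> x \<and> x \<le> y \<and> y \<le> b) \<and>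
        pairwise (\<lambda>p q. disjnt {fst p<..<snd p} {fst q<..<snd q}) I \<and>
        (\<Sum>(x, y)\<in>I. y - x) < d
        \<longrightarrow> (\<Sum>(x, y)\<in>I. \<bar>f y - f x\<bar>) < e)"

definition wave_solution :: "(real \<Rightarrow> real) \<Rightarrow> real \<Rightarrow> real \<Rightarrow> (real \<Rightarrow> real) \<Rightarrow> bool" where
  "wave_solution c l T u \<longleftrightarrow>
     Ck_on 1 u {0..T} \<and>
     abs_continuous_on_interval 0 T (deriv_on {0..T} u) \<and>
     (AE t in lebesgue_on {0<..<T}.
        deriv_on {0..T} u differentiable (at t) \<and>
        vector_derivative (deriv_on {0..T} u) (at t) + l\<^sup>2 * (c t)\<^sup>2 * u t = 0)"

definition energy :: "real \<Rightarrow> real \<Rightarrow> (real \<Rightarrow> real) \<Rightarrow> real \<Rightarrow> real" where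
  "energy l T u t = (deriv_on {0..T} u t)\<^sup>2 + l\<^sup>2 * (u t)\<^sup>2"

text \<open>
  The supremum is taken in the extended reals, so that it would be \<open>\<infinity>\<close> (and not an
  unspecified real number) if the energies were unbounded; accordingly the logarithm is
  extended by \<open>log \<infinity> = \<infinity>\<close> and \<open>log 0 = -\<infinity>\<close>.
\<close>

definition ereal_log :: "ereal \<Rightarrow> ereal" where
  "ereal_log x = (if x = \<infinity> then \<infinity> else if x \<le> 0 then -\<infinity> else ereal (ln (real_of_ereal x)))"

definition growth :: "(real \<Rightarrow> real) \<Rightarrow> real \<Rightarrow> real \<Rightarrow> ereal" where
  "growth c l T =
     ereal_log (Sup {ereal (energy l T u t) | u t.
                       wave_solution c l T u \<and> energy l T u 0 \<le> 1 \<and> t \<in> {0..T}})"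

definition admissible :: "real \<Rightarrow> real \<Rightarrow> real \<Rightarrow> nat \<Rightarrow> real \<Rightarrow> real \<Rightarrow> (real \<Rightarrow> real) set" where
  "admissible m1 m2 e k T l =
     {\<gamma>. Ck_on k \<gamma> {0..T} \<and>
         (\<forall>x\<in>{0..T}. m1 \<le> \<gamma> x \<and> \<gamma> x \<le> m2) \<and>
         (\<forall>j\<in>{1..k - 1}. \<forall>x\<in>{0..T}. \<bar>higher_deriv_on {0..T} j \<gamma> x\<bar> \<le> e * l ^ j)}"

text \<open>
  A real infimum: for \<open>m1 \<le> m2\<close> the admissible class contains the constants in \<open>[m1,m2]\<close>
  (when \<open>0 \<le> e\<close> and \<open>0 < l\<close>), and the functional is nonnegative.
\<close>

definition constrained_min ::
  "real \<Rightarrow> real \<Rightarrow> real \<Rightarrow> nat \<Rightarrow> real \<Rightarrow> (real \<Rightarrow> real) \<Rightarrow> real \<Rightarrow> real" where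
  "constrained_min m1 m2 e k T g l =
     (INF \<gamma>\<in>admissible m1 m2 e k T l.
        1 / l ^ (k - 1) * (LINT x:{0<..<T}|lebesgue. \<bar>higher_deriv_on {0..T} k \<gamma> x\<bar>) +
        l * (LINT x:{0<..<T}|lebesgue. \<bar>\<gamma> x - g x\<bar>))"

end

theory Submission
  imports Defs
begin

text \<open>
  For \<open>\<gamma>\<close> close to \<open>1 / c\<close>, the equation \<open>u'' + (\<lambda> / \<gamma>)\<^sup>2 * u = 0\<close> has the WKB solutions \<open>exp (\<integral> \<phi>)\<close> with
  \<open>\<phi> = \<lambda> * (\<i> + p) / \<gamma>\<close>, where \<open>p\<close> solves a Riccati equation.  Iterating that equation \<open>k - 1\<close> times from
  \<open>p = 0\<close> yields a differential polynomial \<open>p\<close> in \<open>\<gamma>\<close> whose residual \<open>\<rho>\<close> is a sum of monomials of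
  total derivative order at least \<open>k\<close>; the derivative constraints with small \<open>\<epsilon>\<close> give \<open>\<bar>p\<bar> \<le> 1 / 2\<close>.
  For a solution \<open>u\<close> of the original equation the quadratic form
  \<open>Q = \<bar>\<gamma> * u' - \<lambda> * (\<i> + p) * u\<bar>\<^sup>2 / (\<gamma> * (1 + Im p))\<close> is comparable to the energy, and its logarithmic
  derivative is at most a constant times \<open>\<lambda> * (\<bar>\<rho>\<bar> + \<bar>\<gamma> - 1 / c\<bar>)\<close>.  It remains to bound \<open>\<integral> \<lambda> * \<bar>\<rho>\<bar>\<close>
  by \<open>1 + \<lambda>\<^sup>1\<^sup>-\<^sup>k * \<integral> \<bar>\<gamma>\<^sup>(\<^sup>k\<^sup>)\<bar>\<close>.  This uses a cover by intervals of length \<open>h\<close> on which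
  \<open>h\<^sup>k\<^sup>-\<^sup>1 * \<integral> \<bar>\<gamma>\<^sup>(\<^sup>k\<^sup>)\<bar> = 1\<close>: interpolation bounds the lower derivatives \<open>\<gamma>\<^sup>(\<^sup>j\<^sup>)\<close> there by
  multiples of \<open>1 / h\<^sup>j\<close>, so that the products in \<open>\<rho>\<close> are controlled by \<open>\<gamma>\<^sup>(\<^sup>k\<^sup>)\<close> alone.
\<close>

section \<open>The WKB iteration\<close>

text \<open>
  Jets are sequences of rescaled derivatives: \<open>f j\<close> stands for \<open>f\<^sup>(\<^sup>j\<^sup>) / l ^ j\<close>, so that
  the derivative of \<open>f j\<close> is \<open>l * f (j + 1)\<close>.
\<close>

definition leibniz :: "(nat \<Rightarrow> complex) \<Rightarrow> (nat \<Rightarrow> complex) \<Rightarrow> nat \<Rightarrow> complex" where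
  "leibniz f g j = (\<Sum>a\<le>j. of_nat (j choose a) * f a * g (j - a))"

lemma leibniz_diff_left: "leibniz (\<lambda>j. f j - g j) h j = leibniz f h j - leibniz g h j"
  by (simp add: leibniz_def algebra_simps sum_subtractf)

lemma leibniz_diff_right: "leibniz h (\<lambda>j. f j - g j) j = leibniz h f j - leibniz h g j"
  by (simp add: leibniz_def algebra_simps sum_subtractf)

lemma leibniz_0 [simp]: "leibniz f g 0 = f 0 * g 0"
  by (simp add: leibniz_def)

lemma leibniz_zero [simp]: "leibniz (\<lambda>_. 0) g j = 0" "leibniz f (\<lambda>_. 0) j = 0"
  by (simp_all add: leibniz_def)

text \<open>Pascal's rule, in the form of a product rule under the shift of jets.\<close>

lemma leibniz_Suc:
  "leibniz f g (Suc j) = leibniz (\<lambda>a. f (Suc a)) g j + leibniz f (\<lambda>a. g (Suc a)) j"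
proof -
  have "leibniz f g (Suc j) = f 0 * g (Suc j) +
      (\<Sum>a\<le>j. of_nat (Suc j choose Suc a) * f (Suc a) * g (j - a))"
    unfolding leibniz_def by (subst sum.atMost_Suc_shift) simp
  also have "(\<Sum>a\<le>j. of_nat (Suc j choose Suc a) * f (Suc a) * g (j - a)) =
      leibniz (\<lambda>a. f (Suc a)) g j + (\<Sum>a\<le>j. of_nat (j choose Suc a) * f (Suc a) * g (j - a))"
    by (simp add: leibniz_def sum.distrib[symmetric] algebra_simps)
  also have "f 0 * g (Suc j) + (leibniz (\<lambda>a. f (Suc a)) g j +
      (\<Sum>a\<le>j. of_nat (j choose Suc a) * f (Suc a) * g (j - a))) =
      leibniz (\<lambda>a. f (Suc a)) g j +
      (\<Sum>a\<le>Suc j. of_nat (j choose a) * f a * g (Suc j - a))"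
    by (subst sum.atMost_Suc_shift) simp
  also have "(\<Sum>a\<le>Suc j. of_nat (j choose a) * f a * g (Suc j - a)) =
      leibniz f (\<lambda>a. g (Suc a)) j"
    by (simp add: leibniz_def Suc_diff_le)
  finally show ?thesis .
qed

lemma has_vector_derivative_leibniz:
  assumes f: "\<And>a. a \<le> j \<Longrightarrow> (f a has_vector_derivative of_real l * f (Suc a) x) (at x within S)"
    and g: "\<And>a. a \<le> j \<Longrightarrow> (g a has_vector_derivative of_real l * g (Suc a) x) (at x within S)"
  shows "((\<lambda>x. leibniz (\<lambda>a. f a x) (\<lambda>a. g a x) j) has_vector_derivative
            of_real l * leibniz (\<lambda>a. f a x) (\<lambda>a. g a x) (Suc j)) (at x within S)"
proof -
  have "((\<lambda>x. \<Sum>a\<le>j. of_nat (j choose a) * (f a x * g (j - a) x)) has_vector_derivative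
     (\<Sum>a\<le>j. of_nat (j choose a) *
        (f a x * (of_real l * g (Suc (j - a)) x) + (of_real l * f (Suc a) x) * g (j - a) x))) (at x within S)"
    by (intro has_vector_derivative_sum has_vector_derivative_mult_right has_vector_derivative_mult f g) auto
  then show ?thesis
    unfolding leibniz_Suc
    by (simp add: leibniz_def sum_distrib_left sum.distrib algebra_simps)
qed

text \<open>Submultiplicativity of \<open>\<omega>\<close> gives every product in the sum the same
  weight, and the binomial coefficients add up to \<open>2 ^ j\<close>. The offsets \<open>m\<close>
  and \<open>n\<close> admit factors whose weights start at a positive order; \<open>2 ^ k\<close>
  in place of \<open>2 ^ j\<close> makes the constant uniform in \<open>j\<close>.\<close>

lemma norm_leibniz_le:
  assumes f: "\<And>a. a \<le> j \<Longrightarrow> norm (f a) \<le> C * \<omega> (m + a)"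
    and g: "\<And>a. a \<le> j \<Longrightarrow> norm (g a) \<le> D * \<omega> (n + a)"
    and \<omega>: "\<And>i i'. i + i' \<le> k \<Longrightarrow> \<omega> i * \<omega> i' \<le> \<omega> (i + i')" and "\<And>i. 0 \<le> \<omega> i"
    and "0 \<le> C" and "0 \<le> D" and "m + n + j \<le> k"
  shows "norm (leibniz f g j) \<le> 2 ^ k * (C * D) * \<omega> (m + n + j)"
proof -
  have "norm (leibniz f g j) \<le> (\<Sum>a\<le>j. of_nat (j choose a) * (C * D * \<omega> (m + n + j)))"
    unfolding leibniz_def
  proof (rule sum_norm_le)
    fix a assume "a \<in> {..j}"
    then have a: "a \<le> j" by simp
    have "norm (f a) * norm (g (j - a)) \<le> (C * \<omega> (m + a)) * (D * \<omega> (n + (j - a)))"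
      using assms a by (intro mult_mono f g) auto
    also have "\<dots> = C * D * (\<omega> (m + a) * \<omega> (n + (j - a)))" by simp
    also have "\<dots> \<le> C * D * \<omega> ((m + a) + (n + (j - a)))"
      using assms a by (intro mult_left_mono \<omega>) auto
    also have "(m + a) + (n + (j - a)) = m + n + j" using a by simp
    finally show "norm (of_nat (j choose a) * f a * g (j - a)) \<le> of_nat (j choose a) * (C * D * \<omega> (m + n + j))"
      by (simp add: norm_mult mult.assoc mult_left_mono)
  qed
  also have "\<dots> = 2 ^ j * (C * D * \<omega> (m + n + j))"
    by (simp add: sum_distrib_right[symmetric] choose_row_sum of_nat_sum[symmetric] del: of_nat_sum)
  also have "\<dots> \<le> 2 ^ k * (C * D * \<omega> (m + n + j))"
    using assms by (intro mult_right_mono power_increasing) auto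
  finally show ?thesis by (simp add: mult.assoc)
qed

text \<open>
  The function \<open>u = exp (\<integral> \<phi>)\<close> with \<open>\<phi> = l * (\<i> + p) / \<gamma>\<close> solves \<open>u'' + (l / \<gamma>)\<^sup>2 * u = 0\<close>
  iff \<open>\<gamma> * p' - (\<i> + p) * \<gamma>' + 2 * \<i> * p + p\<^sup>2 = 0\<close> (derivatives rescaled by \<open>l\<close>).
  The recursion solves this for the \<open>p\<close> in \<open>2 * \<i> * p\<close>.
\<close>

primrec wkb :: "(nat \<Rightarrow> complex) \<Rightarrow> nat \<Rightarrow> nat \<Rightarrow> complex" where
  "wkb G 0 = (\<lambda>j. 0)"
| "wkb G (Suc n) = (\<lambda>j. \<i> / 2 * (leibniz G (\<lambda>a. wkb G n (Suc a)) j
      - leibniz (wkb G n) (\<lambda>a. G (Suc a)) j - \<i> * G (Suc j) + leibniz (wkb G n) (wkb G n) j))"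

text \<open>Each iterate is again a jet: its entries are the rescaled derivatives of its entry
  \<open>0\<close>. One iteration consumes one derivative of \<open>G\<close>, hence the range
  \<open>n + j\<close>.\<close>

lemma has_vector_derivative_wkb:
  assumes "\<And>a. a \<le> n + j \<Longrightarrow> (G a has_vector_derivative of_real l * G (Suc a) x) (at x within S)"
  shows "((\<lambda>x. wkb (\<lambda>a. G a x) n j) has_vector_derivative
            of_real l * wkb (\<lambda>a. G a x) n (Suc j)) (at x within S)"
  using assms
proof (induction n arbitrary: j)
  case 0
  then show ?case by simp
next
  case (Suc n)
  have IH: "((\<lambda>x. wkb (\<lambda>a. G a x) n i) has_vector_derivative
            of_real l * wkb (\<lambda>a. G a x) n (Suc i)) (at x within S)" if "i \<le> Suc j" for i
    using that Suc.prems by (intro Suc.IH) auto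
  have G: "(G a has_vector_derivative of_real l * G (Suc a) x) (at x within S)" if "a \<le> Suc j" for a
    using that Suc.prems by auto
  have "((\<lambda>x. wkb (\<lambda>a. G a x) (Suc n) j) has_vector_derivative
      \<i> / 2 * (of_real l * leibniz (\<lambda>a. G a x) (\<lambda>a. wkb (\<lambda>a. G a x) n (Suc a)) (Suc j)
      - of_real l * leibniz (wkb (\<lambda>a. G a x) n) (\<lambda>a. G (Suc a) x) (Suc j)
      - \<i> * (of_real l * G (Suc (Suc j)) x)
      + of_real l * leibniz (wkb (\<lambda>a. G a x) n) (wkb (\<lambda>a. G a x) n) (Suc j))) (at x within S)"
    unfolding wkb.simps
    by (intro has_vector_derivative_mult_right has_vector_derivative_add has_vector_derivative_diff
        has_vector_derivative_leibniz IH G) auto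
  then show ?case by (simp add: algebra_simps)
qed

lemma continuous_on_leibniz:
  assumes "\<And>a. a \<le> j \<Longrightarrow> continuous_on S (f a)" and "\<And>a. a \<le> j \<Longrightarrow> continuous_on S (g a)"
  shows "continuous_on S (\<lambda>x. leibniz (\<lambda>a. f a x) (\<lambda>a. g a x) j)"
  unfolding leibniz_def by (intro continuous_intros assms) auto

lemma continuous_on_wkb:
  assumes "\<And>a. a \<le> n + j \<Longrightarrow> continuous_on S (G a)"
  shows "continuous_on S (\<lambda>x. wkb (\<lambda>a. G a x) n j)"
  using assms
proof (induction n arbitrary: j)
  case 0
  then show ?case by simp
next
  case (Suc n)
  have IH: "continuous_on S (\<lambda>x. wkb (\<lambda>a. G a x) n i)" if "i \<le> Suc j" for i
    using that Suc.prems by (intro Suc.IH) auto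
  have G: "continuous_on S (G a)" if "a \<le> Suc j" for a
    using that Suc.prems by auto
  show ?case
    unfolding wkb.simps by (intro continuous_on_leibniz continuous_intros IH G) auto
qed

text \<open>The recursion inverts the linear term \<open>2 * \<i> * p\<close>, so the defect of the
  Riccati equation at one iterate is, up to a constant factor, the step to the next iterate.
  Estimating residuals is thereby reduced to estimating increments.\<close>

lemma wkb_residual:
  "G 0 * wkb G n 1 - (\<i> + wkb G n 0) * G 1 + 2 * \<i> * wkb G n 0 + (wkb G n 0)\<^sup>2 =
     - 2 * \<i> * (wkb G (Suc n) 0 - wkb G n 0)"
  by (simp add: algebra_simps power2_eq_square)

text \<open>The inhomogeneous term \<open>\<i> * G (Suc j)\<close> cancels in the difference, and
  the quadratic term splits into two bilinear ones. Each remaining term pairs the old increment with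
  one further derivative, or with an iterate, whose order is at least one. This is why increments
  gain one order per iteration.\<close>

lemma wkb_increment_Suc:
  defines "D \<equiv> \<lambda>G n j. wkb G (Suc n) j - wkb G n j"
  shows "D G (Suc n) j = \<i> / 2 * (leibniz G (\<lambda>a. D G n (Suc a)) j - leibniz (D G n) (\<lambda>a. G (Suc a)) j
     + (leibniz (D G n) (wkb G (Suc n)) j + leibniz (wkb G n) (D G n) j))"
proof -
  have "D G (Suc n) j = wkb G (Suc (Suc n)) j - wkb G (Suc n) j" by (simp add: D_def)
  also have "\<dots> = \<i> / 2 * ((leibniz G (\<lambda>a. wkb G (Suc n) (Suc a)) j - leibniz G (\<lambda>a. wkb G n (Suc a)) j)
     - (leibniz (wkb G (Suc n)) (\<lambda>a. G (Suc a)) j - leibniz (wkb G n) (\<lambda>a. G (Suc a)) j)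
     + (leibniz (wkb G (Suc n)) (wkb G (Suc n)) j - leibniz (wkb G n) (wkb G n) j))"
    unfolding wkb.simps(2)[of _ "Suc n"] by (subst (2) wkb.simps(2)) (simp only: algebra_simps)
  also have "leibniz (wkb G (Suc n)) (wkb G (Suc n)) j - leibniz (wkb G n) (wkb G n) j =
      leibniz (D G n) (wkb G (Suc n)) j + leibniz (wkb G n) (D G n) j"
    unfolding D_def leibniz_diff_left leibniz_diff_right by simp
  finally show ?thesis unfolding D_def leibniz_diff_left leibniz_diff_right .
qed

text \<open>
  The weight \<open>\<omega> j\<close> controls the \<open>j\<close>-th derivative of \<open>G\<close>.  It is monotone only below \<open>k\<close>, because
  \<open>\<omega> k\<close> will contain the derivative of order \<open>k\<close> itself, which is merely integrable.
\<close>

lemma wkb_bounds: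
  assumes "Suc n \<le> k" and "0 \<le> B"
  shows "\<exists>C\<ge>0. \<forall>G \<omega>. (\<forall>j\<le>k. norm (G j) \<le> B * \<omega> j) \<longrightarrow> (\<forall>i. 0 \<le> \<omega> i) \<longrightarrow>
    (\<forall>i i'. i + i' \<le> k \<longrightarrow> \<omega> i * \<omega> i' \<le> \<omega> (i + i')) \<longrightarrow>
    (\<forall>i i'. i \<le> i' \<longrightarrow> i' < k \<longrightarrow> \<omega> i' \<le> \<omega> i) \<longrightarrow>
    (\<forall>j. Suc n + j \<le> k \<longrightarrow> norm (wkb G (Suc n) j - wkb G n j) \<le> C * \<omega> (Suc n + j)) \<and>
    (\<forall>j. n + j < k \<longrightarrow> norm (wkb G n j) \<le> C * \<omega> (Suc j))"
  using assms(1)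
proof (induction n)
  case 0
  \<comment> \<open>The first iterate is \<open>G (Suc j) / 2\<close>.\<close>
  show ?case using assms(2)
    by (intro exI[of _ "B / 2"]) (auto simp: norm_mult norm_divide)
next
  case (Suc n)
  then obtain C where C: "C \<ge> 0" and bd: "\<And>G \<omega>. (\<forall>j\<le>k. norm (G j) \<le> B * \<omega> j) \<Longrightarrow> (\<forall>i. 0 \<le> \<omega> i) \<Longrightarrow>
    (\<forall>i i'. i + i' \<le> k \<longrightarrow> \<omega> i * \<omega> i' \<le> \<omega> (i + i')) \<Longrightarrow>
    (\<forall>i i'. i \<le> i' \<longrightarrow> i' < k \<longrightarrow> \<omega> i' \<le> \<omega> i) \<Longrightarrow>
    (\<forall>j. Suc n + j \<le> k \<longrightarrow> norm (wkb G (Suc n) j - wkb G n j) \<le> C * \<omega> (Suc n + j)) \<and>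
    (\<forall>j. n + j < k \<longrightarrow> norm (wkb G n j) \<le> C * \<omega> (Suc j))"
    by auto
  \<comment> \<open>\<open>2 * C\<close> serves the new iterate, which is the old one plus its
    increment; the four products are the constants of the four terms in
    \<open>wkb_increment_Suc\<close>.\<close>
  define C' where "C' = 2 * C + (2 ^ k * (B * C) + 2 ^ k * (C * B) + (2 ^ k * (C * (2 * C)) + 2 ^ k * (C * C)))"
  have C': "C' \<ge> 2 * C" "C' \<ge> 2 ^ k * (B * C) + 2 ^ k * (C * B) + (2 ^ k * (C * (2 * C)) + 2 ^ k * (C * C))"
    using C assms(2) by (auto simp: C'_def)
  show ?case
  proof (intro exI[of _ C'] conjI allI impI)
    show "C' \<ge> 0" using C' C by linarith
    fix G :: "nat \<Rightarrow> complex" and \<omega> :: "nat \<Rightarrow> real"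
    assume hG: "\<forall>j\<le>k. norm (G j) \<le> B * \<omega> j" and h0: "\<forall>i. 0 \<le> \<omega> i"
      and hm: "\<forall>i i'. i + i' \<le> k \<longrightarrow> \<omega> i * \<omega> i' \<le> \<omega> (i + i')"
      and ha: "\<forall>i i'. i \<le> i' \<longrightarrow> i' < k \<longrightarrow> \<omega> i' \<le> \<omega> i"
    define D where "D j = wkb G (Suc n) j - wkb G n j" for j
    have D: "norm (D j) \<le> C * \<omega> (Suc n + j)" if "Suc n + j \<le> k" for j
      using bd[OF hG h0 hm ha] that unfolding D_def by blast
    have P: "norm (wkb G n j) \<le> C * \<omega> (Suc j)" if "n + j < k" for j
      using bd[OF hG h0 hm ha] that by blast
    have P': "norm (wkb G (Suc n) j) \<le> (2 * C) * \<omega> (Suc j)" if j: "Suc n + j < k" for j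
    proof -
      have "wkb G (Suc n) j = wkb G n j + D j" unfolding D_def by simp
      also have "norm \<dots> \<le> C * \<omega> (Suc j) + C * \<omega> (Suc n + j)"
        using j by (intro order_trans[OF norm_triangle_ineq] add_mono P D) auto
      \<comment> \<open>The weights may be compared because \<open>Suc n + j\<close> stays below
        \<open>k\<close>.\<close>
      also have "C * \<omega> (Suc n + j) \<le> C * \<omega> (Suc j)"
        using ha j C by (intro mult_left_mono) auto
      finally show ?thesis by simp
    qed
    {
      fix j assume "Suc n + j < k"
      then show "norm (wkb G (Suc n) j) \<le> C' * \<omega> (Suc j)"
        using P'[of j] mult_right_mono[OF C'(1), of "\<omega> (Suc j)"] h0 by fastforce
    }
    fix j assume j: "Suc (Suc n) + j \<le> k"
    \<comment> \<open>The three ways in which the order is shared between the two factors of a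
      product: all of it on the shifted increment, or \<open>Suc n\<close> on the increment and
      \<open>1\<close> on the other factor, in either position.\<close>
    have w: "Suc (Suc n) + j = 0 + Suc (Suc n) + j" "Suc (Suc n) + j = Suc n + 1 + j" "Suc (Suc n) + j = 1 + Suc n + j"
      by simp_all
    note nl = norm_leibniz_le[of j _ _ \<omega> _ _ _ _ k]
    have L1: "norm (leibniz G (\<lambda>a. D (Suc a)) j) \<le> 2 ^ k * (B * C) * \<omega> (Suc (Suc n) + j)"
      unfolding w(1) by (rule nl) (use j hG hm h0 C assms(2) D[of "Suc _"] in auto)
    have L2: "norm (leibniz D (\<lambda>a. G (Suc a)) j) \<le> 2 ^ k * (C * B) * \<omega> (Suc (Suc n) + j)"
      unfolding w(2) by (rule nl) (use j hG hm h0 C assms(2) D in auto)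
    have L3: "norm (leibniz D (wkb G (Suc n)) j) \<le> 2 ^ k * (C * (2 * C)) * \<omega> (Suc (Suc n) + j)"
      unfolding w(2) by (rule nl) (use j hm h0 C D P' in \<open>auto simp del: wkb.simps\<close>)
    have L4: "norm (leibniz (wkb G n) D j) \<le> 2 ^ k * (C * C) * \<omega> (Suc (Suc n) + j)"
      unfolding w(3) by (rule nl) (use j hm h0 C D P in \<open>auto simp del: wkb.simps\<close>)
    let ?X = "leibniz G (\<lambda>a. D (Suc a)) j - leibniz D (\<lambda>a. G (Suc a)) j
     + (leibniz D (wkb G (Suc n)) j + leibniz (wkb G n) D j)"
    have "norm (wkb G (Suc (Suc n)) j - wkb G (Suc n) j) = norm (\<i> / 2 * ?X)"
      unfolding wkb_increment_Suc D_def ..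
    also have "\<dots> \<le> norm ?X" by (simp add: norm_mult)
    also have "\<dots> \<le> norm (leibniz G (\<lambda>a. D (Suc a)) j) + norm (leibniz D (\<lambda>a. G (Suc a)) j)
       + (norm (leibniz D (wkb G (Suc n)) j) + norm (leibniz (wkb G n) D j))"
      by (intro order_trans[OF norm_triangle_ineq] add_mono norm_triangle_ineq4 order_refl)
    also have "\<dots> \<le> (2 ^ k * (B * C) + 2 ^ k * (C * B) + (2 ^ k * (C * (2 * C)) + 2 ^ k * (C * C))) * \<omega> (Suc (Suc n) + j)"
      using L1 L2 L3 L4 by (simp only: distrib_right)
    also have "\<dots> \<le> C' * \<omega> (Suc (Suc n) + j)"
      using C' h0 by (intro mult_right_mono) auto
    finally show "norm (wkb G (Suc (Suc n)) j - wkb G (Suc n) j) \<le> C' * \<omega> (Suc (Suc n) + j)" .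
  qed
qed

text \<open>Geometric weights are submultiplicative and decreasing, and only the weight of order
  \<open>k\<close> has to carry \<open>norm (G k)\<close>. The second bound is free of it because
  \<open>wkb G (k - 1) 0\<close> involves orders below \<open>k\<close> only.\<close>

lemma wkb_pointwise_bounds:
  assumes "1 \<le> k" and "1 \<le> B"
  shows "\<exists>C\<ge>0. \<forall>G \<eta>. 0 \<le> \<eta> \<longrightarrow> \<eta> \<le> 1 \<longrightarrow> (\<forall>j<k. norm (G j) \<le> B * \<eta> ^ j) \<longrightarrow>
     norm (wkb G k 0 - wkb G (k - 1) 0) \<le> C * (\<eta> ^ k + norm (G k)) \<and> norm (wkb G (k - 1) 0) \<le> C * \<eta>"
proof -
  obtain n where n: "k = Suc n" using assms(1) by (cases k) auto
  obtain C where C: "C \<ge> 0" and bd: "\<And>G \<omega>. (\<forall>j\<le>k. norm (G j) \<le> B * \<omega> j) \<Longrightarrow> (\<forall>i. 0 \<le> \<omega> i) \<Longrightarrow>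
    (\<forall>i i'. i + i' \<le> k \<longrightarrow> \<omega> i * \<omega> i' \<le> \<omega> (i + i')) \<Longrightarrow>
    (\<forall>i i'. i \<le> i' \<longrightarrow> i' < k \<longrightarrow> \<omega> i' \<le> \<omega> i) \<Longrightarrow>
    (\<forall>j. Suc n + j \<le> k \<longrightarrow> norm (wkb G (Suc n) j - wkb G n j) \<le> C * \<omega> (Suc n + j)) \<and>
    (\<forall>j. n + j < k \<longrightarrow> norm (wkb G n j) \<le> C * \<omega> (Suc j))"
    using wkb_bounds[of n k B] assms n by auto
  show ?thesis
  proof (rule exI[of _ C], rule conjI[OF C], intro allI impI, rule conjI)
    fix G :: "nat \<Rightarrow> complex" and \<eta> :: real
    assume \<eta>: "0 \<le> \<eta>" "\<eta> \<le> 1" and G: "\<forall>j<k. norm (G j) \<le> B * \<eta> ^ j"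
    define \<omega> where "\<omega> j = (if j < k then \<eta> ^ j else \<eta> ^ k + norm (G k))" for j
    have *: "(\<forall>j. Suc n + j \<le> k \<longrightarrow> norm (wkb G (Suc n) j - wkb G n j) \<le> C * \<omega> (Suc n + j)) \<and>
      (\<forall>j. n + j < k \<longrightarrow> norm (wkb G n j) \<le> C * \<omega> (Suc j))"
    proof (rule bd[of G \<omega>])
      show "\<forall>i. 0 \<le> \<omega> i" using \<eta> by (auto simp: \<omega>_def)
      show "\<forall>j\<le>k. norm (G j) \<le> B * \<omega> j"
      proof (intro allI impI)
        fix j assume "j \<le> k"
        have "norm (G k) \<le> 1 * (\<eta> ^ k + norm (G k))" using \<eta> by simp
        also have "\<dots> \<le> B * (\<eta> ^ k + norm (G k))" using \<eta> assms(2) by (intro mult_right_mono) auto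
        finally show "norm (G j) \<le> B * \<omega> j" using \<open>j \<le> k\<close> G by (cases "j < k") (auto simp: \<omega>_def)
      qed
      show "\<forall>i i'. i \<le> i' \<longrightarrow> i' < k \<longrightarrow> \<omega> i' \<le> \<omega> i"
        using \<eta> by (auto simp: \<omega>_def intro: power_decreasing)
      show "\<forall>i i'. i + i' \<le> k \<longrightarrow> \<omega> i * \<omega> i' \<le> \<omega> (i + i')"
      proof (intro allI impI)
        fix i i' assume "i + i' \<le> k"
        then consider "i + i' < k" | "i = 0" | "i' = 0" | "i < k" "i' < k" "i + i' = k" by linarith
        then show "\<omega> i * \<omega> i' \<le> \<omega> (i + i')"
        proof cases
          \<comment> \<open>Two orders below \<open>k\<close> that add up to \<open>k\<close> give
            exactly \<open>\<eta> ^ k\<close>; the summand \<open>norm (G k)\<close> is spare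
            room.\<close>
          case 4
          then have "\<omega> i * \<omega> i' = \<eta> ^ k" by (simp add: \<omega>_def power_add[symmetric])
          then show ?thesis using 4 by (simp add: \<omega>_def)
        qed (use assms(1) in \<open>auto simp: \<omega>_def power_add\<close>)
      qed
    qed
    show "norm (wkb G k 0 - wkb G (k - 1) 0) \<le> C * (\<eta> ^ k + norm (G k))"
      using *[THEN conjunct1, rule_format, of 0] by (simp add: n \<omega>_def del: wkb.simps)
    show "norm (wkb G (k - 1) 0) \<le> C * \<eta>"
    proof (cases n)
      \<comment> \<open>Here \<open>k = 1\<close>, so \<open>\<omega> 1\<close> would contain
        \<open>norm (G k)\<close>; the bound holds instead because \<open>wkb G 0\<close>
        vanishes.\<close>
      case 0
      then show ?thesis using C \<eta> by (simp add: n)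
    next
      case (Suc n')
      then show ?thesis
        using *[THEN conjunct2, rule_format, of 0] by (simp add: n \<omega>_def del: wkb.simps)
    qed
  qed
qed

section \<open>Interpolation on balanced intervals\<close>

text \<open>Induction by thirds: the two outer thirds each contain a point where \<open>g j\<close>
  is small, and the mean value theorem between these points, which are at least a third of the
  interval apart, yields a point where \<open>g (Suc j)\<close> is small.\<close>

lemma ex_small_derivative:
  "\<exists>C\<ge>0. \<forall>(g :: nat \<Rightarrow> real \<Rightarrow> real) a b M. a < b \<longrightarrow>
     (\<forall>i<j. \<forall>x\<in>{a..b}. (g i has_real_derivative g (Suc i) x) (at x within {a..b})) \<longrightarrow>
     (\<forall>x\<in>{a..b}. \<bar>g 0 x\<bar> \<le> M) \<longrightarrow> (\<exists>\<xi>\<in>{a..b}. \<bar>g j \<xi>\<bar> \<le> C * M / (b - a) ^ j)"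
proof (induction j)
  case 0
  show ?case by (intro exI[of _ 1]) fastforce
next
  case (Suc j)
  then obtain C where C: "C \<ge> 0" and IH: "\<And>(g :: nat \<Rightarrow> real \<Rightarrow> real) a b M. a < b \<Longrightarrow>
     (\<forall>i<j. \<forall>x\<in>{a..b}. (g i has_real_derivative g (Suc i) x) (at x within {a..b})) \<Longrightarrow>
     (\<forall>x\<in>{a..b}. \<bar>g 0 x\<bar> \<le> M) \<Longrightarrow> (\<exists>\<xi>\<in>{a..b}. \<bar>g j \<xi>\<bar> \<le> C * M / (b - a) ^ j)"
    by blast
  show ?case
  \<comment> \<open>The factor \<open>2\<close> comes from subtracting two values of
    \<open>g j\<close>, and \<open>3 ^ Suc j\<close> from replacing \<open>b - a\<close> by a third
    of it.\<close>
  proof (intro exI[of _ "6 * 3 ^ j * C"] conjI allI impI)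
    show "0 \<le> 6 * 3 ^ j * C" using C by simp
    fix g :: "nat \<Rightarrow> real \<Rightarrow> real" and a b M :: real
    assume "a < b"
      and der: "\<forall>i<Suc j. \<forall>x\<in>{a..b}. (g i has_real_derivative g (Suc i) x) (at x within {a..b})"
      and M: "\<forall>x\<in>{a..b}. \<bar>g 0 x\<bar> \<le> M"
    define h where "h = (b - a) / 3"
    have h: "h > 0" "b = a + 3 * h" using \<open>a < b\<close> by (auto simp: h_def field_simps)
    have sub: "\<exists>\<xi>\<in>{c..c+h}. \<bar>g j \<xi>\<bar> \<le> C * M / h ^ j" if "a \<le> c" "c + h \<le> b" for c
    proof -
      have "\<exists>\<xi>\<in>{c..c+h}. \<bar>g j \<xi>\<bar> \<le> C * M / (c + h - c) ^ j"
      proof (rule IH)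
        show "\<forall>i<j. \<forall>x\<in>{c..c + h}. (g i has_real_derivative g (Suc i) x) (at x within {c..c + h})"
        proof (intro allI impI ballI)
          fix i x assume "i < j" "x \<in> {c..c + h}"
          then show "(g i has_real_derivative g (Suc i) x) (at x within {c..c + h})"
            using that by (intro DERIV_subset[OF der[rule_format, of i x]]) auto
        qed
      qed (use M that h in auto)
      then show ?thesis by simp
    qed
    obtain x where x: "x \<in> {a..a+h}" "\<bar>g j x\<bar> \<le> C * M / h ^ j" using sub[of a] h by auto
    obtain y where y: "y \<in> {a+2*h..a+3*h}" "\<bar>g j y\<bar> \<le> C * M / h ^ j" using sub[of "a+2*h"] h by (auto simp: algebra_simps)
    have xy: "y - x \<ge> h" "x < y" using x y h by auto
    have "\<exists>\<xi>\<in>{x<..<y}. g j y - g j x = (\<lambda>v. g (Suc j) \<xi> * v) (y - x)"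
    proof (rule mvt_simple[OF xy(2)])
      fix t assume t: "x \<le> t" "t \<le> y"
      then have "(g j has_real_derivative g (Suc j) t) (at t within {x..y})"
        using x y h by (intro DERIV_subset[OF der[rule_format, of j t]]) auto
      then show "(g j has_derivative (*) (g (Suc j) t)) (at t within {x..y})"
        by (simp add: has_field_derivative_def)
    qed
    then obtain \<xi> where \<xi>: "\<xi> \<in> {x<..<y}" "g j y - g j x = g (Suc j) \<xi> * (y - x)" by blast
    have "\<bar>g (Suc j) \<xi>\<bar> * h \<le> \<bar>g (Suc j) \<xi>\<bar> * (y - x)"
      using xy by (intro mult_left_mono) auto
    also have "\<dots> = \<bar>g j y - g j x\<bar>" using \<xi>(2) xy by (simp add: abs_mult)
    also have "\<dots> \<le> 2 * (C * M / h ^ j)" using x y by linarith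
    finally have "\<bar>g (Suc j) \<xi>\<bar> \<le> 2 * (C * M / h ^ j) / h" using h by (simp add: field_simps)
    also have "\<dots> = 6 * 3 ^ j * C * M / (b - a) ^ Suc j"
      using h by (simp add: power_mult_distrib field_simps)
    finally show "\<exists>\<xi>\<in>{a..b}. \<bar>g (Suc j) \<xi>\<bar> \<le> 6 * 3 ^ j * C * M / (b - a) ^ Suc j"
      using \<xi>(1) x y h by (intro bexI[of _ \<xi>]) auto
  qed
qed

lemma abs_diff_le_integral_abs_derivative:
  fixes f f' :: "real \<Rightarrow> real"
  assumes "\<And>x. x \<in> {a..b} \<Longrightarrow> (f has_real_derivative f' x) (at x within {a..b})"
    and cont: "continuous_on {a..b} f'" and "x \<in> {a..b}" "y \<in> {a..b}"
  shows "\<bar>f x - f y\<bar> \<le> integral {a..b} (\<lambda>t. \<bar>f' t\<bar>)"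
proof -
  have *: "\<bar>f y - f x\<bar> \<le> integral {a..b} (\<lambda>t. \<bar>f' t\<bar>)" if "a \<le> x" "x \<le> y" "y \<le> b" for x y
  proof -
    have sub: "{x..y} \<subseteq> {a..b}" using that by auto
    have "(f' has_integral (f y - f x)) {x..y}"
      using that assms(1) sub
      by (intro fundamental_theorem_of_calculus)
         (auto simp: has_real_derivative_iff_has_vector_derivative[symmetric] intro!: DERIV_subset[OF _ sub])
    then have "\<bar>f y - f x\<bar> = \<bar>integral {x..y} f'\<bar>" by (simp add: integral_unique)
    also have "\<dots> \<le> integral {x..y} (\<lambda>t. \<bar>f' t\<bar>)"
      using continuous_on_subset[OF cont sub]
      by (intro integral_norm_bound_integral[where 'a=real, simplified] integrable_continuous_real
          continuous_intros) auto
    also have "\<dots> \<le> integral {a..b} (\<lambda>t. \<bar>f' t\<bar>)"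
      using continuous_on_subset[OF cont sub] cont
      by (intro integral_subset_le sub integrable_continuous_real continuous_intros) auto
    finally show ?thesis .
  qed
  show ?thesis
    using *[of x y] *[of y x] assms(3,4) by (cases "x \<le> y") (auto simp: abs_minus_commute)
qed

text \<open>Descent from order \<open>k - 1\<close>: each order is small at one point by
  \<open>ex_small_derivative\<close>, and its oscillation is controlled by the next order, at the
  top by the integral of \<open>\<bar>g k\<bar>\<close>. The powers of \<open>b - a\<close> are
  those dictated by scaling, so \<open>C\<close> does not depend on the interval.\<close>

lemma interpolation_bound:
  fixes M :: real
  assumes "1 \<le> k" and "0 \<le> M"
  shows "\<exists>C\<ge>0. \<forall>(g :: nat \<Rightarrow> real \<Rightarrow> real) a b. a < b \<longrightarrow>
     (\<forall>i<k. \<forall>x\<in>{a..b}. (g i has_real_derivative g (Suc i) x) (at x within {a..b})) \<longrightarrow>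
     continuous_on {a..b} (g k) \<longrightarrow> (\<forall>x\<in>{a..b}. \<bar>g 0 x\<bar> \<le> M) \<longrightarrow>
     (b - a) ^ (k - 1) * integral {a..b} (\<lambda>x. \<bar>g k x\<bar>) \<le> 1 \<longrightarrow>
     (\<forall>j<k. \<forall>x\<in>{a..b}. \<bar>g j x\<bar> \<le> C / (b - a) ^ j)"
proof -
  obtain K where K0: "\<And>j. K j \<ge> 0" and K: "\<And>j (g :: nat \<Rightarrow> real \<Rightarrow> real) a b M. a < b \<Longrightarrow>
     (\<forall>i<j. \<forall>x\<in>{a..b}. (g i has_real_derivative g (Suc i) x) (at x within {a..b})) \<Longrightarrow>
     (\<forall>x\<in>{a..b}. \<bar>g 0 x\<bar> \<le> M) \<Longrightarrow> (\<exists>\<xi>\<in>{a..b}. \<bar>g j \<xi>\<bar> \<le> K j * M / (b - a) ^ j)"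
    using ex_small_derivative by metis
  \<comment> \<open>The induction variable \<open>d\<close> counts how many orders below
    \<open>k - 1\<close> are already covered.\<close>
  have "\<exists>C\<ge>0. \<forall>(g :: nat \<Rightarrow> real \<Rightarrow> real) a b. a < b \<longrightarrow>
     (\<forall>i<k. \<forall>x\<in>{a..b}. (g i has_real_derivative g (Suc i) x) (at x within {a..b})) \<longrightarrow>
     continuous_on {a..b} (g k) \<longrightarrow> (\<forall>x\<in>{a..b}. \<bar>g 0 x\<bar> \<le> M) \<longrightarrow>
     (b - a) ^ (k - 1) * integral {a..b} (\<lambda>x. \<bar>g k x\<bar>) \<le> 1 \<longrightarrow>
     (\<forall>j<k. k - 1 \<le> j + d \<longrightarrow> (\<forall>x\<in>{a..b}. \<bar>g j x\<bar> \<le> C / (b - a) ^ j))" for d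
  proof (induction d)
    case 0
    show ?case
    proof (intro exI[of _ "K (k - 1) * M + 1"] conjI allI impI ballI)
      show "0 \<le> K (k - 1) * M + 1" using K0 assms by simp
      fix g :: "nat \<Rightarrow> real \<Rightarrow> real" and a b j x
      assume ab: "a < b"
        and der: "\<forall>i<k. \<forall>x\<in>{a..b}. (g i has_real_derivative g (Suc i) x) (at x within {a..b})"
        and cont: "continuous_on {a..b} (g k)" and M: "\<forall>x\<in>{a..b}. \<bar>g 0 x\<bar> \<le> M"
        and int: "(b - a) ^ (k - 1) * integral {a..b} (\<lambda>x. \<bar>g k x\<bar>) \<le> 1"
        and j: "j < k" "k - 1 \<le> j + 0" and x: "x \<in> {a..b}"
      have j: "j = k - 1" "Suc j = k" using j by auto
      obtain \<xi> where \<xi>: "\<xi> \<in> {a..b}" "\<bar>g j \<xi>\<bar> \<le> K j * M / (b - a) ^ j"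
        using K[where j = j and g = g and M = M, OF ab _ M] der j by auto
      have "\<bar>g j x - g j \<xi>\<bar> \<le> integral {a..b} (\<lambda>t. \<bar>g k t\<bar>)"
      proof (rule abs_diff_le_integral_abs_derivative[OF _ cont x \<xi>(1)])
        show "(g j has_real_derivative g k t) (at t within {a..b})" if "t \<in> {a..b}" for t
          using der[rule_format, of j t] j that by simp
      qed
      also have "\<dots> \<le> 1 / (b - a) ^ j" using int ab j by (simp add: field_simps)
      finally have "\<bar>g j x\<bar> \<le> K j * M / (b - a) ^ j + 1 / (b - a) ^ j" using \<xi> by linarith
      then show "\<bar>g j x\<bar> \<le> (K (k - 1) * M + 1) / (b - a) ^ j"
        using j by (simp add: add_divide_distrib)
    qed
  next
    case (Suc d)
    then obtain C where C: "C \<ge> 0" and IH: "\<And>(g :: nat \<Rightarrow> real \<Rightarrow> real) a b. a < b \<Longrightarrow>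
     (\<forall>i<k. \<forall>x\<in>{a..b}. (g i has_real_derivative g (Suc i) x) (at x within {a..b})) \<Longrightarrow>
     continuous_on {a..b} (g k) \<Longrightarrow> (\<forall>x\<in>{a..b}. \<bar>g 0 x\<bar> \<le> M) \<Longrightarrow>
     (b - a) ^ (k - 1) * integral {a..b} (\<lambda>x. \<bar>g k x\<bar>) \<le> 1 \<Longrightarrow>
     (\<forall>j<k. k - 1 \<le> j + d \<longrightarrow> (\<forall>x\<in>{a..b}. \<bar>g j x\<bar> \<le> C / (b - a) ^ j))"
      by blast
    \<comment> \<open>The only order that is new at this stage. If the subtraction truncates, no new
      order exists and the case that uses \<open>j0\<close> does not arise.\<close>
    define j0 where "j0 = k - 1 - Suc d"
    show ?case
    proof (intro exI[of _ "K j0 * M + C"] conjI allI impI ballI)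
      show "0 \<le> K j0 * M + C" using K0 assms C by simp
      fix g :: "nat \<Rightarrow> real \<Rightarrow> real" and a b j x
      assume ab: "a < b"
        and der: "\<forall>i<k. \<forall>x\<in>{a..b}. (g i has_real_derivative g (Suc i) x) (at x within {a..b})"
        and cont: "continuous_on {a..b} (g k)" and M: "\<forall>x\<in>{a..b}. \<bar>g 0 x\<bar> \<le> M"
        and int: "(b - a) ^ (k - 1) * integral {a..b} (\<lambda>x. \<bar>g k x\<bar>) \<le> 1"
        and j: "j < k" "k - 1 \<le> j + Suc d" and x: "x \<in> {a..b}"
      have bd: "\<bar>g j x\<bar> \<le> C / (b - a) ^ j" if "j < k" "k - 1 \<le> j + d" "x \<in> {a..b}" for j x
        using IH[OF ab der cont M int] that by blast
      show "\<bar>g j x\<bar> \<le> (K j0 * M + C) / (b - a) ^ j"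
      proof (cases "k - 1 \<le> j + d")
        case True
        have "C / (b - a) ^ j \<le> (K j0 * M + C) / (b - a) ^ j"
          using K0 assms ab by (intro divide_right_mono) auto
        then show ?thesis using bd[OF j(1) True x] by linarith
      next
        case False
        then have j0: "j = j0" "Suc j < k" using j by (auto simp: j0_def)
        obtain \<xi> where \<xi>: "\<xi> \<in> {a..b}" "\<bar>g j \<xi>\<bar> \<le> K j * M / (b - a) ^ j"
          using K[where j = j and g = g and M = M, OF ab _ M] der j by auto
        have "norm (g j x - g j \<xi>) \<le> C / (b - a) ^ Suc j * norm (x - \<xi>)"
        proof (rule field_differentiable_bound)
          show "norm (g (Suc j) z) \<le> C / (b - a) ^ Suc j" if "z \<in> {a..b}" for z
            using bd[of "Suc j" z] that j0 j by simp
        qed (use der j x \<xi> in auto)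
        also have "\<dots> \<le> C / (b - a) ^ Suc j * (b - a)"
          using C ab x \<xi> by (intro mult_left_mono) auto
        also have "\<dots> = C / (b - a) ^ j" using ab by simp
        finally have "\<bar>g j x\<bar> \<le> K j * M / (b - a) ^ j + C / (b - a) ^ j" using \<xi> by simp
        then show ?thesis using j0 by (simp add: add_divide_distrib)
      qed
    qed
  qed
  from this[of k] obtain C where "C \<ge> 0" and C: "\<And>(g :: nat \<Rightarrow> real \<Rightarrow> real) a b. a < b \<Longrightarrow>
     (\<forall>i<k. \<forall>x\<in>{a..b}. (g i has_real_derivative g (Suc i) x) (at x within {a..b})) \<Longrightarrow>
     continuous_on {a..b} (g k) \<Longrightarrow> (\<forall>x\<in>{a..b}. \<bar>g 0 x\<bar> \<le> M) \<Longrightarrow>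
     (b - a) ^ (k - 1) * integral {a..b} (\<lambda>x. \<bar>g k x\<bar>) \<le> 1 \<Longrightarrow>
     (\<forall>j<k. k - 1 \<le> j + k \<longrightarrow> (\<forall>x\<in>{a..b}. \<bar>g j x\<bar> \<le> C / (b - a) ^ j))"
    by blast
  show ?thesis
  proof (intro exI[of _ C] conjI allI impI ballI)
    fix g :: "nat \<Rightarrow> real \<Rightarrow> real" and a b j x
    assume "a < b" "\<forall>i<k. \<forall>x\<in>{a..b}. (g i has_real_derivative g (Suc i) x) (at x within {a..b})"
      "continuous_on {a..b} (g k)" "\<forall>x\<in>{a..b}. \<bar>g 0 x\<bar> \<le> M"
      "(b - a) ^ (k - 1) * integral {a..b} (\<lambda>x. \<bar>g k x\<bar>) \<le> 1" "j < k" "x \<in> {a..b}"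
    then show "\<bar>g j x\<bar> \<le> C / (b - a) ^ j" by (intro C[rule_format]) auto
  qed fact
qed

text \<open>
  Consecutive balanced intervals are cut off from the left; the last one, where too little of \<open>g\<close>
  remains, is extended to the left until it is balanced, which costs the factor 2.
\<close>

lemma integral_le_by_balanced_intervals:
  fixes f g :: "real \<Rightarrow> real"
  assumes f: "continuous_on {A..B} f" and g: "continuous_on {A..B} g"
    and f0: "\<And>x. x \<in> {A..B} \<Longrightarrow> 0 \<le> f x" and g0: "\<And>x. x \<in> {A..B} \<Longrightarrow> 0 \<le> g x" and "1 \<le> k" and "0 \<le> C"
    and bal: "\<And>a b. \<lbrakk>A \<le> a; a < b; b \<le> B; (b - a) ^ (k - 1) * integral {a..b} g = 1\<rbrakk>
                \<Longrightarrow> integral {a..b} f \<le> C * integral {a..b} g"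
    and "A \<le> B" and "1 \<le> (B - A) ^ (k - 1) * integral {A..B} g"
  shows "integral {A..B} f \<le> 2 * C * integral {A..B} g"
proof -
  have intf: "f integrable_on {a..b}" if "A \<le> a" "b \<le> B" for a b
    using that by (intro integrable_continuous_real continuous_on_subset[OF f]) auto
  have intg: "g integrable_on {a..b}" if "A \<le> a" "b \<le> B" for a b
    using that by (intro integrable_continuous_real continuous_on_subset[OF g]) auto
  obtain G where G: "\<And>x. x \<in> {A..B} \<Longrightarrow> g x \<le> G" "G \<ge> 0"
  proof -
    have "compact (g ` {A..B})" using g by (intro compact_continuous_image) auto
    then obtain G where "\<forall>y\<in>g ` {A..B}. \<bar>y\<bar> \<le> G" using compact_imp_bounded bounded_real by blast
    then have "g x \<le> max G 0" if "x \<in> {A..B}" for x using that by (auto simp: abs_le_iff le_max_iff_disj)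
    then show thesis by (rule that) auto
  qed
  \<comment> \<open>A lower bound for the length of balanced intervals: on a shorter one the
    integral of \<open>g\<close> is below \<open>1\<close> and the power of the length is at most
    \<open>1\<close>. It makes the cutting procedure terminate.\<close>
  define \<delta> where "\<delta> = 1 / (G + 1)"
  have \<delta>: "\<delta> > 0" "\<delta> \<le> 1" "\<delta> * G < 1" using G(2) by (auto simp: \<delta>_def field_simps)
  have long: "\<delta> \<le> s - a" if s: "A \<le> a" "a \<le> s" "s \<le> B" "(s - a) ^ (k - 1) * integral {a..s} g = 1" for a s
  proof (rule ccontr)
    assume "\<not> \<delta> \<le> s - a"
    then have sa: "s - a < \<delta>" by simp
    have "integral {a..s} g \<le> integral {a..s} (\<lambda>_. G)"
      using s by (intro integral_le intg G) auto
    then have "integral {a..s} g \<le> (s - a) * G" using s by simp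
    also have "\<dots> \<le> \<delta> * G" using sa G by (intro mult_right_mono) auto
    finally have "integral {a..s} g < 1" using \<delta> by linarith
    moreover have "0 \<le> integral {a..s} g" using s by (intro integral_nonneg intg g0) auto
    moreover have "(s - a) ^ (k - 1) \<le> 1" using s sa \<delta> by (intro power_le_one) auto
    ultimately have "(s - a) ^ (k - 1) * integral {a..s} g < 1"
      using s by (metis mult_left_le_one_le le_less_trans diff_ge_0_iff_ge zero_le_power)
    then show False using s by simp
  qed
  \<comment> \<open>Each cut shortens the remaining interval by at least \<open>\<delta>\<close>, so
    \<open>n\<close> bounds the number of cuts still possible.\<close>
  have "integral {a..B} f \<le> 2 * C * integral {a..B} g"
    if "A \<le> a" "a \<le> B" "B - a \<le> real n * \<delta>" "1 \<le> (B - a) ^ (k - 1) * integral {a..B} g" for n a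
    using that
  proof (induction n arbitrary: a)
    case 0
    then have "a = B" by simp
    then show ?case using 0 by simp
  next
    case (Suc n)
    define \<Phi> where "\<Phi> s = (s - a) ^ (k - 1) * integral {a..s} g" for s
    have "continuous_on {a..B} \<Phi>"
      unfolding \<Phi>_def using Suc.prems by (intro continuous_intros indefinite_integral_continuous_1 intg) auto
    then have "\<exists>s\<ge>a. s \<le> B \<and> \<Phi> s = 1"
      using Suc.prems by (intro IVT') (auto simp: \<Phi>_def)
    then obtain s where s: "a \<le> s" "s \<le> B" "(s - a) ^ (k - 1) * integral {a..s} g = 1"
      by (auto simp: \<Phi>_def)
    then have sa: "\<delta> \<le> s - a" using long Suc.prems by blast
    have "integral {a..s} f \<le> C * integral {a..s} g"
      using s sa \<delta> Suc.prems by (intro bal) auto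
    note as = this
    have splitf: "integral {a..B} f = integral {a..s} f + integral {s..B} f"
      using s Suc.prems by (intro Henstock_Kurzweil_Integration.integral_combine[symmetric] intf) auto
    have splitg: "integral {a..B} g = integral {a..s} g + integral {s..B} g"
      using s Suc.prems by (intro Henstock_Kurzweil_Integration.integral_combine[symmetric] intg) auto
    have gas: "0 \<le> integral {a..s} g" using s Suc.prems by (intro integral_nonneg intg g0) auto
    have gsB: "0 \<le> integral {s..B} g" using s Suc.prems by (intro integral_nonneg intg g0) auto
    show ?case
    proof (cases "1 \<le> (B - s) ^ (k - 1) * integral {s..B} g")
      case True
      have "integral {s..B} f \<le> 2 * C * integral {s..B} g"
        using True s sa Suc.prems by (intro Suc.IH) (auto simp: algebra_simps)
      moreover have "C * integral {a..s} g \<le> 2 * C * integral {a..s} g"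
        using gas \<open>0 \<le> C\<close> by simp
      ultimately show ?thesis unfolding splitf splitg using as by (simp add: algebra_simps)
    next
      case False
      define \<Psi> where "\<Psi> r = (B - r) ^ (k - 1) * integral {r..B} g" for r
      have cont: "continuous_on {a..B} \<Psi>"
        unfolding \<Psi>_def using Suc.prems by (intro continuous_intros indefinite_integral_continuous_1' intg) auto
      \<comment> \<open>\<open>\<Psi>\<close> is at least \<open>1\<close> at \<open>a\<close> and
        below \<open>1\<close> at \<open>s\<close>. Hence \<open>r\<close> lies in
        \<open>{a..s}\<close>, and the balanced intervals \<open>{a..s}\<close> and
        \<open>{r..B}\<close> cover \<open>{a..B}\<close>; the integral of \<open>g\<close> over
        each is at most that over \<open>{a..B}\<close>.\<close>
      have "\<exists>r\<ge>a. r \<le> s \<and> \<Psi> r = 1"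
        using Suc.prems False s continuous_on_subset[OF cont, of "{a..s}"]
        by (intro IVT2') (auto simp: \<Psi>_def)
      then obtain r where r: "a \<le> r" "r \<le> s" "(B - r) ^ (k - 1) * integral {r..B} g = 1"
        by (auto simp: \<Psi>_def)
      have "r \<noteq> B" using r(3) by auto
      then have "integral {r..B} f \<le> C * integral {r..B} g"
        using r s Suc.prems by (intro bal) auto
      moreover have "integral {s..B} f \<le> integral {r..B} f"
        using r s Suc.prems by (intro integral_subset_le intf) (auto intro!: f0)
      moreover have "integral {r..B} g \<le> integral {a..B} g"
        using r s Suc.prems by (intro integral_subset_le intg) (auto intro!: g0)
      then have "C * integral {r..B} g \<le> C * integral {a..B} g"
        using \<open>0 \<le> C\<close> by (rule mult_left_mono)
      moreover have "C * integral {a..s} g \<le> C * integral {a..B} g"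
        using \<open>0 \<le> C\<close> splitg gsB by (intro mult_left_mono) auto
      ultimately show ?thesis using as splitf by linarith
    qed
  qed
  note main = this
  obtain n :: nat where "(B - A) / \<delta> \<le> real n" using real_arch_simple by blast
  then have "B - A \<le> real n * \<delta>" using \<delta> by (simp add: field_simps)
  then show ?thesis using assms(8,9) by (intro main[of A n]) auto
qed

section \<open>Absolutely continuous functions\<close>

text \<open>Lets a small open cover of a null set bound the total length of the intervals of a
  division that are tagged in that set.\<close>

lemma sum_interval_lengths_le_measure:
  fixes I :: "(real \<times> real) set"
  assumes "finite I" and le: "\<And>p. p \<in> I \<Longrightarrow> fst p \<le> snd p"
    and "pairwise (\<lambda>p q. disjnt {fst p<..<snd p} {fst q<..<snd q}) I"
    and sub: "\<And>p. p \<in> I \<Longrightarrow> {fst p<..<snd p} \<subseteq> U" and U: "U \<in> lmeasurable"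
  shows "(\<Sum>(x, y)\<in>I. y - x) \<le> measure lebesgue U"
proof -
  have "(\<Sum>(x, y)\<in>I. y - x) = (\<Sum>p\<in>I. measure lebesgue {fst p<..<snd p})"
    by (rule sum.cong) (auto dest: le)
  also have "\<dots> = measure lebesgue (\<Union>p\<in>I. {fst p<..<snd p})"
    using assms(1,3) by (intro measure_UNION' [symmetric]) auto
  also have "\<dots> \<le> measure lebesgue U"
    using sub U \<open>finite I\<close> by (intro measure_mono_fmeasurable sets.finite_UN) (auto simp: UN_subset_iff)
  finally show ?thesis .
qed

text \<open>
  The gauge is the usual one off \<open>N\<close>, and on \<open>N\<close> it forces the intervals into an open set of small
  measure, where absolute continuity applies.
\<close>

lemma fundamental_theorem_of_calculus_abs_continuous:
  fixes f :: "real \<Rightarrow> real"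
  assumes "a \<le> b" and ac: "abs_continuous_on_interval a b f" and N: "negligible N"
    and vecd: "\<And>x. x \<in> {a..b} - N \<Longrightarrow> (f has_vector_derivative f' x) (at x within {a..b})"
  shows "(f' has_integral (f b - f a)) {a..b}"
proof -
  \<comment> \<open>With the value \<open>0\<close> on \<open>N\<close>, a tag in \<open>N\<close>
    contributes only an increment of \<open>f\<close> to the error, which absolute continuity can
    absorb.\<close>
  define g where "g x = (if x \<in> N then 0 else f' x)" for x
  have "(g has_integral (f b - f a)) {a..b}"
  proof (cases "a = b")
    case True
    then show ?thesis by (auto intro: has_integral_refl)
  next
    case False
    with \<open>a \<le> b\<close> have "a < b" by simp
    show ?thesis
      unfolding has_integral_factor_content_real
    proof (intro allI impI)
      fix e :: real
      assume "e > 0"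
      \<comment> \<open>One half of the error is for tags in \<open>N\<close>, the other for the
        remaining tags.\<close>
      define e2 where "e2 = e / 2"
      have "e2 > 0" using \<open>e > 0\<close> by (simp add: e2_def)
      have "e2 * (b - a) > 0" using \<open>e2 > 0\<close> \<open>a < b\<close> by simp
      then obtain \<delta> where "\<delta> > 0" and \<delta>: "\<forall>I :: (real \<times> real) set. finite I \<and>
          (\<forall>(x, y)\<in>I. a \<le> x \<and> x \<le> y \<and> y \<le> b) \<and>
          pairwise (\<lambda>p q. disjnt {fst p<..<snd p} {fst q<..<snd q}) I \<and>
          (\<Sum>(x, y)\<in>I. y - x) < \<delta> \<longrightarrow> (\<Sum>(x, y)\<in>I. \<bar>f y - f x\<bar>) < e2 * (b - a)"
        by (rule ac[unfolded abs_continuous_on_interval_def, rule_format, THEN exE]) (elim conjE that)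
      obtain U where U: "open U" "N \<subseteq> U" "U - N \<in> lmeasurable" "emeasure lebesgue (U - N) < ennreal \<delta>"
        using sets_lebesgue_outer_open[of N \<delta>] N \<open>\<delta> > 0\<close> negligible_imp_sets by blast
      have Ueq: "U = (U - N) \<union> N" using U(2) by auto
      have UL: "U \<in> lmeasurable"
        using U(3) negligible_imp_measurable[OF N] Ueq fmeasurable.Un by metis
      have "measure lebesgue U = measure lebesgue (U - N)"
        using N UL by (simp add: measure_Diff_null_set negligible_iff_null_sets fmeasurableD)
      also have "\<dots> < \<delta>"
        using U(3,4) \<open>\<delta> > 0\<close> by (simp add: emeasure_eq_measure2 ennreal_less_iff)
      finally have mU: "measure lebesgue U < \<delta>" .
      have "\<forall>x. \<exists>d>0. (x \<in> {a..b} - N \<longrightarrow>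
          (\<forall>y\<in>{a..b}. norm (y-x) < d \<longrightarrow> norm (f y - f x - (y-x) *\<^sub>R f' x) \<le> e2 * norm (y-x)))
          \<and> (x \<in> N \<longrightarrow> ball x d \<subseteq> U)"
      proof
        fix x
        show "\<exists>d>0. (x \<in> {a..b} - N \<longrightarrow>
          (\<forall>y\<in>{a..b}. norm (y-x) < d \<longrightarrow> norm (f y - f x - (y-x) *\<^sub>R f' x) \<le> e2 * norm (y-x)))
          \<and> (x \<in> N \<longrightarrow> ball x d \<subseteq> U)"
        proof (cases "x \<in> N")
          case True
          then show ?thesis using U(1,2) open_contains_ball by blast
        next
          case False
          then show ?thesis
            using vecd[unfolded has_vector_derivative_def has_derivative_within_alt, of x] \<open>e2 > 0\<close>
            by (cases "x \<in> {a..b}") (auto intro: zero_less_one)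
        qed
      qed
      then obtain d where d: "\<And>x. 0 < d x"
         "\<And>x y. \<lbrakk>x \<in> {a..b} - N; y \<in> {a..b}; norm (y-x) < d x\<rbrakk>
                \<Longrightarrow> norm (f y - f x - (y-x) *\<^sub>R f' x) \<le> e2 * norm (y-x)"
         "\<And>x. x \<in> N \<Longrightarrow> ball x (d x) \<subseteq> U"
        by metis
      show "\<exists>d. gauge d \<and> (\<forall>p. p tagged_division_of {a..b} \<and> d fine p \<longrightarrow>
         norm ((\<Sum>(x, k)\<in>p. measure lborel k *\<^sub>R g x) - (f b - f a)) \<le> e * measure lborel {a..b})"
      proof (rule exI, safe)
        show "gauge (\<lambda>x. ball x (d x))"
          using d(1) gauge_ball_dependent by blast
      next
        fix p
        assume ptag: "p tagged_division_of {a..b}" and finep: "(\<lambda>x. ball x (d x)) fine p"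
        have fin: "finite p" using ptag by blast
        have ba: "b - a = (\<Sum>(x,K)\<in>p. Sup K - Inf K)" "f b - f a = (\<Sum>(x,K)\<in>p. f(Sup K) - f(Inf K))"
          using additive_tagged_division_1[where f= "\<lambda>x. x"] additive_tagged_division_1[where f= f]
                \<open>a \<le> b\<close> ptag by auto
        have kab: "\<exists>u v. K = {u..v} \<and> u \<le> v \<and> x \<in> K \<and> a \<le> u \<and> v \<le> b \<and> Inf K = u \<and> Sup K = v
            \<and> measure lborel K = v - u \<and> K \<subseteq> ball x (d x)" if xK: "(x, K) \<in> p" for x K
        proof -
          obtain u v where uv: "K = cbox u v" using ptag xK by blast
          have "x \<in> K" "K \<subseteq> {a..b}" using ptag xK by blast+
          moreover have "K \<subseteq> ball x (d x)" using finep xK by blast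
          ultimately show ?thesis using uv by (intro exI[of _ u] exI[of _ v]) auto
        qed
        define h where "h = (\<lambda>(x, K). measure lborel K *\<^sub>R g x - (f (Sup K) - f (Inf K)))"
        define r where "r = {q \<in> p. fst q \<in> N}"
        \<comment> \<open>Degenerate intervals add nothing to the sum. Once they are removed,
          disjointness of interiors makes the passage from tagged intervals to pairs of endpoints
          injective.\<close>
        define r' where "r' = {q \<in> r. Inf (snd q) < Sup (snd q)}"
        define J where "J = (\<lambda>q. (Inf (snd q), Sup (snd q))) ` r'"
        have disj: "disjnt {Inf (snd q)<..<Sup (snd q)} {Inf (snd q')<..<Sup (snd q')}"
          if q: "q \<in> p" "q' \<in> p" "q \<noteq> q'" for q q'
        proof -
          obtain x K x' K' where qe: "q = (x,K)" "q' = (x',K')" by fastforce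
          have "interior K \<inter> interior K' = {}"
            using tagged_division_ofD(5)[OF ptag] q qe by metis
          moreover obtain u v u' v' where "K = {u..v}" "K' = {u'..v'}" "Inf K = u" "Sup K = v" "Inf K' = u'" "Sup K' = v'"
            using kab[of x K] kab[of x' K'] q qe by blast
          ultimately show ?thesis using qe by (auto simp: disjnt_def)
        qed
        have inj: "inj_on (\<lambda>q. (Inf (snd q), Sup (snd q))) r'"
        proof (rule inj_onI)
          fix q q' assume q: "q \<in> r'" "q' \<in> r'" "(Inf (snd q), Sup (snd q)) = (Inf (snd q'), Sup (snd q'))"
          then have "\<not> disjnt {Inf (snd q)<..<Sup (snd q)} {Inf (snd q')<..<Sup (snd q')}"
            by (auto simp: r'_def disjnt_def)
          then show "q = q'" using disj[of q q'] q by (auto simp: r'_def r_def)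
        qed
        have "(\<Sum>(x, y)\<in>J. \<bar>f y - f x\<bar>) < e2 * (b - a)"
        proof (rule \<delta>[THEN spec, THEN mp], intro conjI)
          show fJ: "finite J" unfolding J_def r'_def r_def using fin by auto
          show Jab: "\<forall>(x, y)\<in>J. a \<le> x \<and> x \<le> y \<and> y \<le> b"
            unfolding J_def r'_def r_def using kab by fastforce
          show pw: "pairwise (\<lambda>p q. disjnt {fst p<..<snd p} {fst q<..<snd q}) J"
          proof (rule pairwiseI)
            fix P Q assume "P \<in> J" "Q \<in> J" "P \<noteq> Q"
            then obtain q q' where "q \<in> r'" "q' \<in> r'" "q \<noteq> q'"
              "P = (Inf (snd q), Sup (snd q))" "Q = (Inf (snd q'), Sup (snd q'))"
              unfolding J_def by blast
            then show "disjnt {fst P<..<snd P} {fst Q<..<snd Q}"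
              using disj[of q q'] by (simp add: r'_def r_def)
          qed
          have "(\<Sum>(x, y)\<in>J. y - x) \<le> measure lebesgue U"
          proof (rule sum_interval_lengths_le_measure[OF fJ _ pw _ UL])
            show "fst q \<le> snd q" if "q \<in> J" for q using Jab that by auto
            show "{fst q<..<snd q} \<subseteq> U" if qJ: "q \<in> J" for q
            proof -
              obtain x K where xK: "(x, K) \<in> p" "x \<in> N" "q = (Inf K, Sup K)"
                using qJ by (auto simp: J_def r'_def r_def)
              then show ?thesis using kab[OF xK(1)] d(3)[OF xK(2)] by fastforce
            qed
          qed
          then show "(\<Sum>(x, y)\<in>J. y - x) < \<delta>" using mU by linarith
        qed
        moreover have "(\<Sum>(x, y)\<in>J. \<bar>f y - f x\<bar>) = (\<Sum>q\<in>r'. \<bar>f (Sup (snd q)) - f (Inf (snd q))\<bar>)"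
          unfolding J_def by (subst sum.reindex[OF inj]) simp
        moreover have "\<dots> = (\<Sum>q\<in>r. \<bar>f (Sup (snd q)) - f (Inf (snd q))\<bar>)"
        proof (rule sum.mono_neutral_left)
          show "finite r" using fin by (auto simp: r_def)
          show "r' \<subseteq> r" by (auto simp: r'_def)
          show "\<forall>i\<in>r - r'. \<bar>f (Sup (snd i)) - f (Inf (snd i))\<bar> = 0"
            using kab by (fastforce simp: r'_def r_def)
        qed
        moreover have "norm (sum h r) \<le> (\<Sum>q\<in>r. \<bar>f (Sup (snd q)) - f (Inf (snd q))\<bar>)"
          by (rule sum_norm_le) (auto simp: h_def r_def g_def)
        ultimately have hr: "norm (sum h r) \<le> e2 * (b - a)" by linarith
        have "norm (sum h (p - r)) \<le> (\<Sum>q\<in>p - r. e2 * (Sup (snd q) - Inf (snd q)))"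
        proof (rule sum_norm_le)
          fix q assume q: "q \<in> p - r"
          obtain x K where qe: "q = (x, K)" by fastforce
          have xK: "(x, K) \<in> p" "x \<notin> N" using q qe by (auto simp: r_def)
          obtain u v where uv: "K = {u..v}" "u \<le> v" "x \<in> K" "a \<le> u" "v \<le> b" "Inf K = u" "Sup K = v"
             "measure lborel K = v - u" "K \<subseteq> ball x (d x)" using kab[OF xK(1)] by blast
          have x: "x \<in> {a..b} - N" using uv xK by auto
          have "u \<in> K" "v \<in> K" using uv by auto
          then have "u \<in> ball x (d x)" "v \<in> ball x (d x)" using uv(9) by blast+
          then have n: "norm (u - x) < d x" "norm (v - x) < d x" by (auto simp: dist_real_def)
          have "norm ((v - u) *\<^sub>R f' x - (f v - f u)) = norm (f u - f x - (u - x) *\<^sub>R f' x - (f v - f x - (v - x) *\<^sub>R f' x))"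
            by (auto simp: algebra_simps)
          also have "\<dots> \<le> norm (f u - f x - (u - x) *\<^sub>R f' x) + norm (f v - f x - (v - x) *\<^sub>R f' x)"
            by (rule norm_triangle_ineq4)
          also have "\<dots> \<le> e2 * norm (u - x) + e2 * norm (v - x)"
            by (intro add_mono d(2) x n) (use uv in auto)
          also have "\<dots> = e2 * (v - u)" using uv by (auto simp: algebra_simps)
          finally show "norm (h q) \<le> e2 * (Sup (snd q) - Inf (snd q))"
            using uv xK by (simp add: qe h_def g_def)
        qed
        also have "\<dots> \<le> (\<Sum>q\<in>p. e2 * (Sup (snd q) - Inf (snd q)))"
          by (rule sum_mono2[OF fin]) (use kab \<open>e2 > 0\<close> in \<open>fastforce intro!: mult_nonneg_nonneg\<close>)+
        also have "\<dots> = e2 * (b - a)"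
          unfolding ba(1) sum_distrib_left by (simp add: case_prod_beta)
        finally have hpr: "norm (sum h (p - r)) \<le> e2 * (b - a)" .
        have "(\<Sum>(x, k)\<in>p. measure lborel k *\<^sub>R g x) - (f b - f a) = sum h p"
          unfolding ba(2) h_def by (simp add: sum_subtractf case_prod_beta)
        also have "\<dots> = sum h (p - r) + sum h r"
          by (rule sum.subset_diff) (auto simp: r_def fin)
        also have "norm \<dots> \<le> e2 * (b - a) + e2 * (b - a)"
          using hr hpr norm_triangle_ineq[of "sum h (p - r)" "sum h r"] by linarith
        also have "\<dots> = e * measure lborel {a..b}" using \<open>a \<le> b\<close> by (simp add: e2_def)
        finally show "norm ((\<Sum>(x, k)\<in>p. measure lborel k *\<^sub>R g x) - (f b - f a)) \<le> e * measure lborel {a..b}" .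
      qed
    qed
  qed
  then show ?thesis
    by (rule has_integral_spike[OF N, rotated]) (auto simp: g_def)
qed

section \<open>Lipschitz functions and their calculus\<close>

lemma lipschitz_imp_abs_continuous_on_interval:
  fixes f :: "real \<Rightarrow> real"
  assumes "L-lipschitz_on {a..b} f"
  shows "abs_continuous_on_interval a b f"
  unfolding abs_continuous_on_interval_def
proof (intro allI impI)
  fix e :: real assume "e > 0"
  have L: "L \<ge> 0" using assms by (rule lipschitz_on_nonneg)
  show "\<exists>d>0. \<forall>I :: (real \<times> real) set.
        finite I \<and> (\<forall>(x, y)\<in>I. a \<le> x \<and> x \<le> y \<and> y \<le> b) \<and>
        pairwise (\<lambda>p q. disjnt {fst p<..<snd p} {fst q<..<snd q}) I \<and>
        (\<Sum>(x, y)\<in>I. y - x) < d \<longrightarrow> (\<Sum>(x, y)\<in>I. \<bar>f y - f x\<bar>) < e"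
  \<comment> \<open>\<open>L + 1\<close> avoids a division by zero when
    \<open>L = 0\<close>.\<close>
  proof (intro exI[of _ "e / (L + 1)"] conjI allI impI; (elim conjE)?)
    show "e / (L + 1) > 0" using \<open>e > 0\<close> L by simp
    fix I :: "(real \<times> real) set"
    assume I: "\<forall>(x, y)\<in>I. a \<le> x \<and> x \<le> y \<and> y \<le> b" and s: "(\<Sum>(x, y)\<in>I. y - x) < e / (L + 1)"
    have le: "(case q of (x, y) \<Rightarrow> \<bar>f y - f x\<bar>) \<le> L * (case q of (x, y) \<Rightarrow> y - x)" if q: "q \<in> I" for q
    proof -
      obtain x y where xy: "q = (x, y)" "a \<le> x" "x \<le> y" "y \<le> b" using q I by (cases q) auto
      then show ?thesis using lipschitz_onD[OF assms, of y x] by (simp add: dist_real_def)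
    qed
    have s0: "0 \<le> (\<Sum>(x, y)\<in>I. y - x)" by (rule sum_nonneg) (use I in auto)
    have "(\<Sum>(x, y)\<in>I. \<bar>f y - f x\<bar>) \<le> L * (\<Sum>(x, y)\<in>I. y - x)"
      unfolding sum_distrib_left by (rule sum_mono) (rule le)
    also have "\<dots> \<le> (L + 1) * (\<Sum>(x, y)\<in>I. y - x)" using s0 by (intro mult_right_mono) auto
    also have "\<dots> < e" using s L by (simp add: field_simps)
    finally show "(\<Sum>(x, y)\<in>I. \<bar>f y - f x\<bar>) < e" .
  qed
qed

text \<open>Compactness bounds both factors. Constants stay existential in this calculus, since only
  the absolute continuity of the final composite matters.\<close>

lemma lipschitz_on_mult_compact:
  fixes f g :: "'a::metric_space \<Rightarrow> real"
  assumes "compact S" and f: "\<exists>L. L-lipschitz_on S f" and g: "\<exists>L. L-lipschitz_on S g"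
  shows "\<exists>L. L-lipschitz_on S (\<lambda>x. f x * g x)"
proof -
  obtain L M where L: "L-lipschitz_on S f" and M: "M-lipschitz_on S g" using f g by blast
  have LM: "L \<ge> 0" "M \<ge> 0" using L M lipschitz_on_nonneg by blast+
  have "compact (f ` S)" "compact (g ` S)"
    using assms(1) lipschitz_on_continuous_on[OF L] lipschitz_on_continuous_on[OF M]
    by (auto intro: compact_continuous_image)
  then obtain B D where "\<forall>y\<in>f ` S. \<bar>y\<bar> \<le> B" "\<forall>y\<in>g ` S. \<bar>y\<bar> \<le> D"
    using compact_imp_bounded bounded_real by metis
  then have B: "\<bar>f x\<bar> \<le> max B 0" "\<bar>g x\<bar> \<le> max D 0" if "x \<in> S" for x
    using that by (auto simp: le_max_iff_disj)
  have "(max B 0 * M + max D 0 * L)-lipschitz_on S (\<lambda>x. f x * g x)"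
  proof (rule lipschitz_onI)
    fix x y assume xy: "x \<in> S" "y \<in> S"
    have "f x * g x - f y * g y = f x * (g x - g y) + g y * (f x - f y)" by (simp add: algebra_simps)
    then have "dist (f x * g x) (f y * g y) \<le> \<bar>f x\<bar> * \<bar>g x - g y\<bar> + \<bar>g y\<bar> * \<bar>f x - f y\<bar>"
      by (simp add: dist_real_def abs_mult[symmetric])
    also have "\<dots> \<le> max B 0 * (M * dist x y) + max D 0 * (L * dist x y)"
      using lipschitz_onD[OF L xy] lipschitz_onD[OF M xy] B xy LM
      by (intro add_mono mult_mono) (auto simp: dist_real_def)
    finally show "dist (f x * g x) (f y * g y) \<le> (max B 0 * M + max D 0 * L) * dist x y"
      by (simp add: algebra_simps)
  qed (use LM in auto)
  then show ?thesis ..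
qed

lemma lipschitz_on_inverse_bounded_below:
  fixes f :: "'a::metric_space \<Rightarrow> real"
  assumes "\<exists>L. L-lipschitz_on S f" and "0 < m" and m: "\<And>x. x \<in> S \<Longrightarrow> m \<le> f x"
  shows "\<exists>L. L-lipschitz_on S (\<lambda>x. 1 / f x)"
proof -
  obtain L where L: "L-lipschitz_on S f" using assms by blast
  have "(L / m\<^sup>2)-lipschitz_on S (\<lambda>x. 1 / f x)"
  proof (rule lipschitz_onI)
    fix x y assume xy: "x \<in> S" "y \<in> S"
    have p: "f x > 0" "f y > 0" using m[OF xy(1)] m[OF xy(2)] \<open>0 < m\<close> by auto
    have "dist (1 / f x) (1 / f y) = \<bar>f x - f y\<bar> / (f x * f y)"
    proof -
      have "1 / f x - 1 / f y = (f y - f x) / (f x * f y)" using p by (simp add: field_simps)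
      then show ?thesis using p by (simp add: dist_real_def abs_minus_commute abs_mult)
    qed
    also have "\<dots> \<le> (L * dist x y) / (m * m)"
      using lipschitz_onD[OF L xy] m xy \<open>0 < m\<close>
      by (intro frac_le mult_mono) (auto simp: dist_real_def intro: order_trans[OF less_imp_le])
    finally show "dist (1 / f x) (1 / f y) \<le> L / m\<^sup>2 * dist x y"
      by (simp add: power2_eq_square)
  qed (use lipschitz_on_nonneg[OF L] in simp)
  then show ?thesis ..
qed

text \<open>The logarithm is a contraction on \<open>{1..}\<close>; the bound is met below by
  \<open>Q + 1\<close> with \<open>Q\<close> nonnegative.\<close>

lemma lipschitz_on_ln:
  fixes f :: "'a::metric_space \<Rightarrow> real"
  assumes "\<exists>L. L-lipschitz_on S f" and m: "\<And>x. x \<in> S \<Longrightarrow> 1 \<le> f x"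
  shows "\<exists>L. L-lipschitz_on S (\<lambda>x. ln (f x))"
proof -
  obtain L where L: "L-lipschitz_on S f" using assms by blast
  have *: "ln x - ln y \<le> \<bar>x - y\<bar>" if "1 \<le> x" "1 \<le> y" for x y :: real
  proof -
    have "ln x - ln y \<le> (x - y) / y"
      using that ln_diff_le[of x y] by simp
    also have "\<dots> \<le> \<bar>x - y\<bar> / 1" using that by (intro frac_le) auto
    finally show ?thesis by simp
  qed
  have "L-lipschitz_on S (\<lambda>x. ln (f x))"
  proof (rule lipschitz_onI)
    fix x y assume xy: "x \<in> S" "y \<in> S"
    have "dist (ln (f x)) (ln (f y)) \<le> dist (f x) (f y)"
      using *[of "f x" "f y"] *[of "f y" "f x"] m xy by (auto simp: dist_real_def)
    also have "\<dots> \<le> L * dist x y" using lipschitz_onD[OF L xy] .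
    finally show "dist (ln (f x)) (ln (f y)) \<le> L * dist x y" .
  qed (rule lipschitz_on_nonneg[OF L])
  then show ?thesis ..
qed

lemma lipschitz_on_C1:
  fixes f f' :: "real \<Rightarrow> real"
  assumes "\<And>x. x \<in> {a..b} \<Longrightarrow> (f has_real_derivative f' x) (at x within {a..b})"
    and "continuous_on {a..b} f'"
  shows "\<exists>L. L-lipschitz_on {a..b} f"
proof -
  have "compact (f' ` {a..b})" using assms(2) by (intro compact_continuous_image) auto
  then obtain B where "\<forall>y\<in>f' ` {a..b}. \<bar>y\<bar> \<le> B" using compact_imp_bounded bounded_real by metis
  then have B: "\<bar>f' x\<bar> \<le> max B 0" if "x \<in> {a..b}" for x using that by (auto simp: le_max_iff_disj)
  have "(max B 0)-lipschitz_on {a..b} f"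
  proof (rule lipschitz_onI)
    fix x y assume "x \<in> {a..b}" "y \<in> {a..b}"
    then have "norm (f x - f y) \<le> max B 0 * norm (x - y)"
      using assms(1) B by (intro field_differentiable_bound[of "{a..b}" f f']) auto
    then show "dist (f x) (f y) \<le> max B 0 * dist x y" by (simp add: dist_norm)
  qed auto
  then show ?thesis ..
qed

lemma lipschitz_on_add_ex:
  fixes f g :: "'a::metric_space \<Rightarrow> real"
  assumes "\<exists>L. L-lipschitz_on S f" and "\<exists>L. L-lipschitz_on S g"
  shows "\<exists>L. L-lipschitz_on S (\<lambda>x. f x + g x)"
  using assms lipschitz_on_add by blast

lemma lipschitz_on_const_ex: "\<exists>L. L-lipschitz_on S (\<lambda>x. c)"
  using lipschitz_on_constant by blast

section \<open>The adiabatic invariant\<close>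

text \<open>
  Here \<open>a + \<i> * s\<close> is \<open>\<i> + p\<close>, and \<open>z1 + \<i> * z2 = G * v - l * (a + \<i> * s) * u\<close> measures the
  deviation of a solution \<open>u\<close> with \<open>v = u'\<close> from the approximate solution \<open>exp (\<integral> l * (\<i> + p) / G)\<close>;
  \<open>r1 + \<i> * r2\<close> is the residual of \<open>p\<close>.
\<close>

lemma adiabatic_invariant_deriv_bound:
  fixes G G' a a' s s' u v w l :: real
  defines "r1 \<equiv> G * a' - a * G' + a\<^sup>2 - s\<^sup>2 + 1" and "r2 \<equiv> G * s' - s * G' + 2 * a * s"
    and "z1 \<equiv> G * v - l * a * u" and "z2 \<equiv> - (l * s * u)"
    and "z1' \<equiv> l * G' * v - G * l\<^sup>2 * w * u - l\<^sup>2 * a' * u - l * a * v" and "z2' \<equiv> - (l\<^sup>2 * s' * u) - l * s * v"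
  assumes "0 < G" "0 < s" "0 < l"
  shows "(2 * (z1 * z1' + z2 * z2') * (G * s) - (z1\<^sup>2 + z2\<^sup>2) * (l * (G' * s + G * s'))) / (G * s)\<^sup>2
     \<le> 3 * l / (G * s) * (sqrt (r1\<^sup>2 + r2\<^sup>2) + \<bar>G\<^sup>2 * w - 1\<bar>) * ((z1\<^sup>2 + z2\<^sup>2) / (G * s))"
proof -
  define q where "q = G\<^sup>2 * w - 1"
  define Z where "Z = z1\<^sup>2 + z2\<^sup>2"
  \<comment> \<open>The conservation law behind the estimate: all terms without a factor
    \<open>r1\<close>, \<open>r2\<close> or \<open>q\<close> cancel. In particular the quotient is
    constant when the residual vanishes and \<open>w\<close> equals the inverse square of
    \<open>G\<close>.\<close>
  have id: "2 * (z1 * z1' + z2 * z2') * (G * s) - Z * (l * (G' * s + G * s')) =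
      - (l * r2 * Z) - 2 * l\<^sup>2 * s * u * (z1 * (r1 + q) + z2 * r2)"
    unfolding Z_def q_def r1_def r2_def z1_def z2_def z1'_def z2'_def by algebra
  define r where "r = sqrt (r1\<^sup>2 + r2\<^sup>2)"
  have r: "\<bar>r1\<bar> \<le> r" "\<bar>r2\<bar> \<le> r" "r \<ge> 0"
    unfolding r_def by (auto simp: real_le_rsqrt)
  have Z: "Z \<ge> 0" "sqrt Z * sqrt Z = Z" unfolding Z_def by auto
  \<comment> \<open>Cauchy-Schwarz in the plane, through Lagrange's identity.\<close>
  have cs: "\<bar>z1 * r1 + z2 * r2\<bar> \<le> sqrt Z * r"
    unfolding r_def Z_def real_sqrt_mult[symmetric]
  proof (rule real_le_rsqrt)
    have "(z1\<^sup>2 + z2\<^sup>2) * (r1\<^sup>2 + r2\<^sup>2) - \<bar>z1 * r1 + z2 * r2\<bar>\<^sup>2 = (z1 * r2 - z2 * r1)\<^sup>2"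
      by (simp add: algebra_simps power2_eq_square)
    then show "\<bar>z1 * r1 + z2 * r2\<bar>\<^sup>2 \<le> (z1\<^sup>2 + z2\<^sup>2) * (r1\<^sup>2 + r2\<^sup>2)"
      using zero_le_power2[of "z1 * r2 - z2 * r1"] by linarith
  qed
  have z1: "\<bar>z1\<bar> \<le> sqrt Z" "\<bar>z2\<bar> \<le> sqrt Z" unfolding Z_def by (auto simp: real_le_rsqrt)
  have lsu: "\<bar>l * s * u\<bar> \<le> sqrt Z" using z1(2) by (simp add: z2_def)
  have "\<bar>z1 * (r1 + q) + z2 * r2\<bar> \<le> \<bar>z1 * r1 + z2 * r2\<bar> + \<bar>z1\<bar> * \<bar>q\<bar>"
    using abs_triangle_ineq[of "z1 * r1 + z2 * r2" "z1 * q"] by (simp add: algebra_simps abs_mult)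
  also have "\<dots> \<le> sqrt Z * r + sqrt Z * \<bar>q\<bar>" using cs z1 by (intro add_mono mult_right_mono) auto
  finally have b: "\<bar>z1 * (r1 + q) + z2 * r2\<bar> \<le> sqrt Z * (r + \<bar>q\<bar>)" by (simp add: algebra_simps)
  have "\<bar>l * s * u\<bar> * \<bar>z1 * (r1 + q) + z2 * r2\<bar> \<le> sqrt Z * (sqrt Z * (r + \<bar>q\<bar>))"
    by (intro mult_mono lsu b) (use Z in auto)
  then have b2: "\<bar>l * s * u * (z1 * (r1 + q) + z2 * r2)\<bar> \<le> Z * (r + \<bar>q\<bar>)"
    using Z(2) by (simp add: abs_mult mult.assoc[symmetric])
  have "- (l * r2 * Z) - 2 * l\<^sup>2 * s * u * (z1 * (r1 + q) + z2 * r2) =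
      l * (- (r2 * Z) - 2 * (l * s * u * (z1 * (r1 + q) + z2 * r2)))"
    by (simp add: algebra_simps power2_eq_square)
  also have "\<dots> \<le> l * (r * Z + 2 * (Z * (r + \<bar>q\<bar>)))"
  proof (rule mult_left_mono)
    have "- (r2 * Z) \<le> r * Z" using r(2) Z(1) by (metis abs_le_D2 mult_minus_left mult_right_mono)
    then show "- (r2 * Z) - 2 * (l * s * u * (z1 * (r1 + q) + z2 * r2)) \<le> r * Z + 2 * (Z * (r + \<bar>q\<bar>))"
      using b2 by linarith
  qed (use assms in simp)
  also have "\<dots> \<le> l * (3 * (r + \<bar>q\<bar>) * Z)"
    using assms Z r by (intro mult_left_mono) (auto simp: algebra_simps)
  finally have "2 * (z1 * z1' + z2 * z2') * (G * s) - Z * (l * (G' * s + G * s')) \<le> l * (3 * (r + \<bar>q\<bar>) * Z)"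
    unfolding id .
  then have "(2 * (z1 * z1' + z2 * z2') * (G * s) - Z * (l * (G' * s + G * s'))) / (G * s)\<^sup>2
      \<le> (l * (3 * (r + \<bar>q\<bar>) * Z)) / (G * s)\<^sup>2"
    by (intro divide_right_mono) auto
  also have "\<dots> = 3 * l / (G * s) * (r + \<bar>q\<bar>) * (Z / (G * s))"
    by (simp add: power2_eq_square)
  finally show ?thesis unfolding Z_def r_def q_def .
qed

section \<open>Regularity of solutions of the wave equation\<close>

lemma AE_lebesgue_on_obtain_negligible:
  assumes "AE t in lebesgue_on S. P t" and "S \<in> sets lebesgue"
  obtains N where "negligible N" "\<And>t. t \<in> S - N \<Longrightarrow> P t"
proof -
  have "AE t in lebesgue. t \<in> S \<longrightarrow> P t"
    using assms by (subst (asm) AE_restrict_space_iff) auto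
  then obtain N where "N \<in> null_sets lebesgue" "{t \<in> space lebesgue. \<not> (t \<in> S \<longrightarrow> P t)} \<subseteq> N"
    unfolding eventually_ae_filter by blast
  then show thesis by (intro that[of N]) (auto simp: negligible_iff_null_sets)
qed

lemma abs_continuous_on_subinterval:
  assumes "abs_continuous_on_interval a b f" and "a \<le> a'" and "b' \<le> b"
  shows "abs_continuous_on_interval a' b' f"
  unfolding abs_continuous_on_interval_def
proof (intro allI impI)
  fix e :: real assume "e > 0"
  then obtain d where "d > 0" and d: "\<forall>I :: (real \<times> real) set.
      finite I \<and> (\<forall>(x, y)\<in>I. a \<le> x \<and> x \<le> y \<and> y \<le> b) \<and>
      pairwise (\<lambda>p q. disjnt {fst p<..<snd p} {fst q<..<snd q}) I \<and>
      (\<Sum>(x, y)\<in>I. y - x) < d \<longrightarrow> (\<Sum>(x, y)\<in>I. \<bar>f y - f x\<bar>) < e"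
    by (rule assms(1)[unfolded abs_continuous_on_interval_def, rule_format, THEN exE]) (elim conjE that)
  show "\<exists>d>0. \<forall>I :: (real \<times> real) set.
      finite I \<and> (\<forall>(x, y)\<in>I. a' \<le> x \<and> x \<le> y \<and> y \<le> b') \<and>
      pairwise (\<lambda>p q. disjnt {fst p<..<snd p} {fst q<..<snd q}) I \<and>
      (\<Sum>(x, y)\<in>I. y - x) < d \<longrightarrow> (\<Sum>(x, y)\<in>I. \<bar>f y - f x\<bar>) < e"
  proof (intro exI[of _ d] conjI allI impI; (elim conjE)?)
    fix I :: "(real \<times> real) set"
    assume *: "finite I" "pairwise (\<lambda>p q. disjnt {fst p<..<snd p} {fst q<..<snd q}) I"
      "(\<Sum>(x, y)\<in>I. y - x) < d" and I: "\<forall>(x, y)\<in>I. a' \<le> x \<and> x \<le> y \<and> y \<le> b'"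
    show "(\<Sum>(x, y)\<in>I. \<bar>f y - f x\<bar>) < e"
    proof (rule d[THEN spec, THEN mp], intro conjI)
      show "\<forall>(x, y)\<in>I. a \<le> x \<and> x \<le> y \<and> y \<le> b"
        using I assms(2,3) by fastforce
    qed (fact *)+
  qed fact
qed

lemma wave_solutionD:
  assumes "wave_solution c l T u" and "x \<in> {0..T}"
  shows "(u has_real_derivative deriv_on {0..T} u x) (at x within {0..T})"
proof -
  have "u differentiable (at x within {0..T})"
    using assms unfolding wave_solution_def Ck_on_def higher_deriv_on_def differentiable_on_def by auto
  then show ?thesis
    by (simp add: has_real_derivative_iff_has_vector_derivative vector_derivative_works deriv_on_def)
qed

lemma wave_solution_continuous_deriv:
  "wave_solution c l T u \<Longrightarrow> continuous_on {0..T} (deriv_on {0..T} u)"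
  by (simp add: wave_solution_def Ck_on_def higher_deriv_on_def)

text \<open>The equation bounds the second derivative off a null set, and the derivative is the
  integral of it by absolute continuity. Everything built from \<open>u\<close> and its derivative
  can then be handled by the Lipschitz calculus.\<close>

lemma wave_solution_deriv_lipschitz:
  assumes u: "wave_solution c l T u" and "negligible N"
    and N: "\<And>x. x \<in> {0<..<T} - N \<Longrightarrow> \<bar>c x\<bar> \<le> B \<and>
        (deriv_on {0..T} u has_real_derivative - (l\<^sup>2 * (c x)\<^sup>2 * u x)) (at x)"
  shows "\<exists>L. L-lipschitz_on {0..T} (deriv_on {0..T} u)"
proof -
  define v where "v = deriv_on {0..T} u"
  define N' where "N' = N \<union> {0, T}"
  have N': "negligible N'" using \<open>negligible N\<close> by (simp add: N'_def)
  have "continuous_on {0..T} u" using wave_solutionD[OF u] DERIV_continuous_on by blast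
  then have "compact (u ` {0..T})" by (intro compact_continuous_image) auto
  then obtain U where U: "\<And>x. x \<in> {0..T} \<Longrightarrow> \<bar>u x\<bar> \<le> U"
    using compact_imp_bounded bounded_real by (metis imageI)
  define K where "K = \<bar>l\<^sup>2 * B\<^sup>2 * U\<bar>"
  define g where "g x = (if x \<in> N' then 0 else - (l\<^sup>2 * (c x)\<^sup>2 * u x))" for x
  have g: "norm (g x) \<le> K" if x: "x \<in> {0..T}" for x
  proof (cases "x \<in> N'")
    case True
    then show ?thesis by (simp add: g_def K_def)
  next
    case False
    then have "\<bar>c x\<bar> \<le> B" using N x by (force simp: N'_def)
    then have cB: "(c x)\<^sup>2 \<le> B\<^sup>2" by (metis abs_ge_zero power2_abs power_mono)
    have U0: "0 \<le> U" using U[OF x] by linarith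
    have "l\<^sup>2 * (c x)\<^sup>2 * \<bar>u x\<bar> \<le> l\<^sup>2 * B\<^sup>2 * U"
      using U[OF x] cB by (intro mult_mono) auto
    then show ?thesis using False U0 by (simp add: g_def K_def abs_mult)
  qed
  have le: "\<bar>v y - v x\<bar> \<le> K * (y - x)" if xy: "0 \<le> x" "x \<le> y" "y \<le> T" for x y
  proof -
    have ac: "abs_continuous_on_interval x y v"
    proof (rule abs_continuous_on_subinterval)
      show "abs_continuous_on_interval 0 T v"
        using u unfolding wave_solution_def v_def by (elim conjE)
    qed (use xy in auto)
    have "(g has_integral (v y - v x)) {x..y}"
    proof (rule fundamental_theorem_of_calculus_abs_continuous[OF xy(2) ac N'])
      fix t assume "t \<in> {x..y} - N'"
      then have t: "t \<in> {0<..<T} - N" "t \<notin> N'" using xy by (auto simp: N'_def)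
      then show "(v has_vector_derivative g t) (at t within {x..y})"
        using N[OF t(1)] by (simp add: g_def v_def has_real_derivative_iff_has_vector_derivative
            has_vector_derivative_at_within)
    qed
    then have "norm (v y - v x) \<le> K * measure lborel (cbox x y)"
      using g xy by (intro has_integral_bound[of K g]) (auto simp: K_def)
    then show ?thesis using xy by simp
  qed
  have "K-lipschitz_on {0..T} v"
  proof (rule lipschitz_onI)
    fix x y assume "x \<in> {0..T}" "y \<in> {0..T}"
    then show "dist (v x) (v y) \<le> K * dist x y"
      using le[of x y] le[of y x] by (cases "x \<le> y") (auto simp: dist_real_def abs_minus_commute)
  qed (simp add: K_def)
  then show ?thesis unfolding v_def by blast
qed

section \<open>The energy estimate\<close>

text \<open>Adding \<open>1\<close> inside the logarithm keeps it differentiable where the invariant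
  vanishes, as for \<open>u = 0\<close>. It costs nothing, because \<open>Q / (Q + 1)\<close> is at
  most \<open>1\<close>.\<close>

lemma ln_adiabatic_invariant_deriv_bound:
  fixes G a s u v :: "real \<Rightarrow> real"
  assumes G: "(G has_real_derivative l * G') (at x)" and a: "(a has_real_derivative l * a') (at x)"
    and s: "(s has_real_derivative l * s') (at x)" and u: "(u has_real_derivative v x) (at x)"
    and v: "(v has_real_derivative - (l\<^sup>2 * c\<^sup>2 * u x)) (at x)"
    and "0 < l" "0 < m" "m \<le> G x" "G x \<le> M" "1 / 2 \<le> s x" "0 < c" "c \<le> b"
  defines "R \<equiv> sqrt ((G x * a' - a x * G' + (a x)\<^sup>2 - (s x)\<^sup>2 + 1)\<^sup>2 + (G x * s' - s x * G' + 2 * a x * s x)\<^sup>2)"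
  shows "\<exists>D. ((\<lambda>x. ln (((G x * v x - l * a x * u x)\<^sup>2 + (- (l * s x * u x))\<^sup>2) / (G x * s x) + 1))
             has_real_derivative D) (at x)
          \<and> D \<le> 6 / m * (1 + b * (M * b + 1)) * (l * R + l * \<bar>G x - 1 / c\<bar>)"
proof -
  define z1 where "z1 x = G x * v x - l * a x * u x" for x
  define z2 where "z2 x = - (l * s x * u x)" for x
  define z1' where "z1' = l * G' * v x - G x * l\<^sup>2 * c\<^sup>2 * u x - l\<^sup>2 * a' * u x - l * a x * v x"
  define z2' where "z2' = - (l\<^sup>2 * s' * u x) - l * s x * v x"
  define Q where "Q x = ((z1 x)\<^sup>2 + (z2 x)\<^sup>2) / (G x * s x)" for x
  define Q' where "Q' = (2 * (z1 x * z1' + z2 x * z2') * (G x * s x)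
      - ((z1 x)\<^sup>2 + (z2 x)\<^sup>2) * (l * (G' * s x + G x * s'))) / (G x * s x)\<^sup>2"
  have pos: "G x > 0" "s x > 0" "G x * s x > 0" using assms by auto
  have z1: "(z1 has_real_derivative z1') (at x)"
    unfolding z1_def[abs_def]
    by (rule derivative_eq_intros G a u v refl)+ (simp add: z1'_def algebra_simps power2_eq_square)
  have z2: "(z2 has_real_derivative z2') (at x)"
    unfolding z2_def[abs_def]
    by (rule derivative_eq_intros s u refl)+ (simp add: z2'_def algebra_simps power2_eq_square)
  have Y: "((\<lambda>x. (z1 x)\<^sup>2 + (z2 x)\<^sup>2) has_real_derivative 2 * (z1 x * z1' + z2 x * z2')) (at x)"
    by (rule derivative_eq_intros z1 z2 refl)+ (simp add: algebra_simps)
  have H: "((\<lambda>x. G x * s x) has_real_derivative l * (G' * s x + G x * s')) (at x)"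
    by (rule derivative_eq_intros G s refl)+ (simp add: algebra_simps)
  have Q: "(Q has_real_derivative Q') (at x)"
    using DERIV_divide[OF Y H] pos by (simp add: Q_def[abs_def] Q'_def power2_eq_square)
  have Q0: "Q x \<ge> 0" using pos by (simp add: Q_def)
  have F: "((\<lambda>x. ln (Q x + 1)) has_real_derivative Q' / (Q x + 1)) (at x)"
    using DERIV_chain2[OF DERIV_ln DERIV_add[OF Q DERIV_const], of 1] Q0
    by (simp add: divide_inverse mult.commute)
  define e where "e = R + \<bar>(G x)\<^sup>2 * c\<^sup>2 - 1\<bar>"
  have e: "e \<ge> 0" unfolding e_def R_def by (intro add_nonneg_nonneg) auto
  have "Q' \<le> 3 * l / (G x * s x) * e * Q x"
    unfolding Q'_def Q_def e_def R_def z1_def z2_def z1'_def z2'_def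
    by (rule adiabatic_invariant_deriv_bound) (use pos assms in auto)
  then have "Q' / (Q x + 1) \<le> 3 * l / (G x * s x) * e * Q x / (Q x + 1)"
    using Q0 by (intro divide_right_mono) auto
  also have "\<dots> = 3 * l / (G x * s x) * e * (Q x / (Q x + 1))" by simp
  also have "\<dots> \<le> 3 * l / (G x * s x) * e * 1"
    using Q0 e pos assms by (intro mult_left_mono) auto
  also have "\<dots> \<le> 3 * l / (m * (1 / 2)) * e * 1"
    using e pos assms by (intro mult_right_mono divide_left_mono mult_mono) auto
  also have "\<dots> = 6 / m * (l * e)" by simp
  finally have D: "Q' / (Q x + 1) \<le> 6 / m * (l * e)" .
  \<comment> \<open>This factorisation makes the mismatch of coefficients linear in the deviation of
    \<open>G\<close> from \<open>1 / c\<close>, as in the functional to be minimised.\<close>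
  have "(G x)\<^sup>2 * c\<^sup>2 - 1 = (G x - 1 / c) * (c * (G x * c + 1))"
    using assms by (simp add: field_simps power2_eq_square)
  moreover have gc: "0 \<le> c * (G x * c + 1)" "c * (G x * c + 1) \<le> b * (M * b + 1)"
    using pos assms by (auto intro!: mult_mono add_mono add_nonneg_nonneg)
  ultimately have "\<bar>(G x)\<^sup>2 * c\<^sup>2 - 1\<bar> \<le> \<bar>G x - 1 / c\<bar> * (b * (M * b + 1))"
    by (simp add: abs_mult mult_left_mono)
  then have "e \<le> R + b * (M * b + 1) * \<bar>G x - 1 / c\<bar>" by (simp add: e_def mult.commute)
  also have "\<dots> \<le> (1 + b * (M * b + 1)) * (R + \<bar>G x - 1 / c\<bar>)"
  proof -
    have "0 \<le> b * (M * b + 1)" using gc by linarith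
    then have "0 \<le> b * (M * b + 1) * R" by (rule mult_nonneg_nonneg) (simp add: R_def)
    then show ?thesis by (simp add: algebra_simps)
  qed
  finally have "l * e \<le> l * ((1 + b * (M * b + 1)) * (R + \<bar>G x - 1 / c\<bar>))"
    using assms by (intro mult_left_mono) auto
  then have "6 / m * (l * e) \<le> 6 / m * (l * ((1 + b * (M * b + 1)) * (R + \<bar>G x - 1 / c\<bar>)))"
    using assms by (intro mult_left_mono) auto
  also have "\<dots> = 6 / m * (1 + b * (M * b + 1)) * (l * R + l * \<bar>G x - 1 / c\<bar>)"
    by (simp only: algebra_simps)
  finally show ?thesis using F D unfolding Q_def z1_def z2_def by fastforce
qed

text \<open>Boundedness on a set of finite measure. Integrability allows the Lebesgue integral of
  the deviation to be read as a gauge integral.\<close>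

lemma set_integrable_abs_diff_inverse:
  fixes c G :: "real \<Rightarrow> real"
  assumes c: "c \<in> borel_measurable (lebesgue_on {0<..<T})"
    and "AE t in lebesgue_on {0<..<T}. b1 \<le> c t \<and> c t \<le> b2" and "0 < b1"
    and G: "continuous_on {0..T} G" and M: "\<And>x. x \<in> {0..T} \<Longrightarrow> \<bar>G x\<bar> \<le> M"
  shows "set_integrable lebesgue {0<..<T} (\<lambda>x. \<bar>G x - 1 / c x\<bar>)"
proof -
  have fin: "finite_measure (lebesgue_on {0<..<T})"
    using lmeasurable_box[of 0 T] by (intro finite_measure_lebesgue_on) (simp only: box_real)
  have "G \<in> borel_measurable (lebesgue_on {0<..<T})"
    by (intro continuous_imp_measurable_on_sets_lebesgue continuous_on_subset[OF G]) auto
  then have m: "(\<lambda>x. \<bar>G x - 1 / c x\<bar>) \<in> borel_measurable (lebesgue_on {0<..<T})"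
    using c by measurable
  have sp: "AE x in lebesgue_on {0<..<T}. x \<in> {0<..<T}"
    by (rule AE_I2) simp
  have "AE x in lebesgue_on {0<..<T}. norm \<bar>G x - 1 / c x\<bar> \<le> M + 1 / b1"
    using assms(2) sp
  proof eventually_elim
    case (elim x)
    then have "\<bar>1 / c x\<bar> \<le> 1 / b1" using \<open>0 < b1\<close> by (simp add: frac_le)
    moreover have "\<bar>G x\<bar> \<le> M" using M elim by auto
    ultimately show ?case using abs_triangle_ineq4[of "G x" "1 / c x"] by simp
  qed
  then have "integrable (lebesgue_on {0<..<T}) (\<lambda>x. \<bar>G x - 1 / c x\<bar>)"
    using m by (rule finite_measure.integrable_const_bound[OF fin])
  then show ?thesis by (simp add: set_integrable_def integrable_restrict_space)
qed

text \<open>A Gronwall argument: \<open>F = ln (Q + 1)\<close> is Lipschitz, hence the integral of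
  its derivative, which is at most \<open>A\<close> off a null set. The factors before the
  exponential come from comparing the energy with \<open>Q\<close> at time \<open>t\<close> and from
  bounding \<open>Q 0 + 1\<close> by the initial energy.\<close>

lemma energy_bound:
  fixes G G' a a' s s' c u :: "real \<Rightarrow> real"
  assumes "0 < T" "0 < l" "0 < m" "0 < b1"
    and Gb: "\<And>x. x \<in> {0..T} \<Longrightarrow> m \<le> G x \<and> G x \<le> M"
    and ab: "\<And>x. x \<in> {0..T} \<Longrightarrow> \<bar>a x\<bar> \<le> 1 / 2"
    and sb: "\<And>x. x \<in> {0..T} \<Longrightarrow> 1 / 2 \<le> s x \<and> s x \<le> 3 / 2"
    and dG: "\<And>x. x \<in> {0..T} \<Longrightarrow> (G has_real_derivative l * G' x) (at x within {0..T})"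
    and da: "\<And>x. x \<in> {0..T} \<Longrightarrow> (a has_real_derivative l * a' x) (at x within {0..T})"
    and ds: "\<And>x. x \<in> {0..T} \<Longrightarrow> (s has_real_derivative l * s' x) (at x within {0..T})"
    and cG': "continuous_on {0..T} G'" and ca': "continuous_on {0..T} a'" and cs': "continuous_on {0..T} s'"
    and c: "c \<in> borel_measurable (lebesgue_on {0<..<T})"
    and cb: "AE t in lebesgue_on {0<..<T}. b1 \<le> c t \<and> c t \<le> b2"
    and u: "wave_solution c l T u" and e0: "energy l T u 0 \<le> 1" and t: "t \<in> {0..T}"
  defines "R \<equiv> \<lambda>x. sqrt ((G x * a' x - a x * G' x + (a x)\<^sup>2 - (s x)\<^sup>2 + 1)\<^sup>2
        + (G x * s' x - s x * G' x + 2 * a x * s x)\<^sup>2)"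
  shows "energy l T u t \<le> (4 + 4 / m\<^sup>2) * (2 * M) * (2 / m * (2 * M\<^sup>2 + 5) + 1) *
     exp (6 / m * (1 + b2 * (M * b2 + 1)) *
       (integral {0..T} (\<lambda>x. l * R x) + l * (LINT x:{0<..<T}|lebesgue. \<bar>G x - 1 / c x\<bar>)))"
proof -
  define v where "v = deriv_on {0..T} u"
  have M: "M > 0" using Gb[of 0] assms(1,3) by auto
  obtain N1 where N1: "negligible N1" "\<And>x. x \<in> {0<..<T} - N1 \<Longrightarrow> b1 \<le> c x \<and> c x \<le> b2"
    using AE_lebesgue_on_obtain_negligible[OF cb] by auto
  have ae: "AE x in lebesgue_on {0<..<T}. v differentiable (at x) \<and>
        vector_derivative v (at x) + l\<^sup>2 * (c x)\<^sup>2 * u x = 0"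
    using u by (simp add: wave_solution_def v_def)
  obtain N2 where N2: "negligible N2" "\<And>x. x \<in> {0<..<T} - N2 \<Longrightarrow> v differentiable (at x) \<and>
        vector_derivative v (at x) + l\<^sup>2 * (c x)\<^sup>2 * u x = 0"
    using AE_lebesgue_on_obtain_negligible[OF ae] by auto
  define N where "N = N1 \<union> N2"
  have N: "negligible N" using N1 N2 by (simp add: N_def)
  have cN: "b1 \<le> c x" "c x \<le> b2" if "x \<in> {0<..<T} - N" for x
    using N1 that by (auto simp: N_def)
  have vN: "(v has_real_derivative - (l\<^sup>2 * (c x)\<^sup>2 * u x)) (at x)" if "x \<in> {0<..<T} - N" for x
  proof -
    have x: "x \<in> {0<..<T} - N2" using that by (auto simp: N_def)
    then have "vector_derivative v (at x) = - (l\<^sup>2 * (c x)\<^sup>2 * u x)" using N2(2)[OF x] by linarith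
    moreover have "(v has_vector_derivative vector_derivative v (at x)) (at x)"
      using N2(2)[OF x] vector_derivative_works by blast
    ultimately show ?thesis by (simp add: has_real_derivative_iff_has_vector_derivative)
  qed
  have du: "(u has_real_derivative v x) (at x within {0..T})" if "x \<in> {0..T}" for x
    using wave_solutionD[OF u that] by (simp add: v_def)
  have cv: "continuous_on {0..T} v" using wave_solution_continuous_deriv[OF u] by (simp add: v_def)
  have cG: "continuous_on {0..T} G" and ca: "continuous_on {0..T} a" and cs: "continuous_on {0..T} s"
    by (rule DERIV_continuous_on[OF dG] DERIV_continuous_on[OF da] DERIV_continuous_on[OF ds]; assumption)+
  have Lv: "\<exists>L. L-lipschitz_on {0..T} v"
    unfolding v_def
  proof (rule wave_solution_deriv_lipschitz[OF u N])
    fix x assume "x \<in> {0<..<T} - N"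
    then show "\<bar>c x\<bar> \<le> b2 \<and> (deriv_on {0..T} u has_real_derivative - (l\<^sup>2 * (c x)\<^sup>2 * u x)) (at x)"
      using cN[of x] vN[of x] \<open>0 < b1\<close> by (auto simp: v_def)
  qed
  have Lu: "\<exists>L. L-lipschitz_on {0..T} u" using lipschitz_on_C1[OF du cv] .
  have LG: "\<exists>L. L-lipschitz_on {0..T} G"
    by (rule lipschitz_on_C1[OF dG]) (auto intro: continuous_intros cG')
  have La: "\<exists>L. L-lipschitz_on {0..T} a"
    by (rule lipschitz_on_C1[OF da]) (auto intro: continuous_intros ca')
  have Ls: "\<exists>L. L-lipschitz_on {0..T} s"
    by (rule lipschitz_on_C1[OF ds]) (auto intro: continuous_intros cs')
  note Lm = lipschitz_on_mult_compact[OF compact_Icc]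
  define z1 where "z1 x = G x * v x - l * a x * u x" for x
  define z2 where "z2 x = - (l * s x * u x)" for x
  define Y where "Y x = (z1 x)\<^sup>2 + (z2 x)\<^sup>2" for x
  define Q where "Q x = Y x / (G x * s x)" for x
  define F where "F x = ln (Q x + 1)" for x
  have Gs: "m * (1 / 2) \<le> G x * s x" "G x * s x \<le> 2 * M" if "x \<in> {0..T}" for x
  proof -
    show "m * (1 / 2) \<le> G x * s x" using Gb[OF that] sb[OF that] assms(3) by (intro mult_mono) auto
    have "G x * s x \<le> M * 2" using Gb[OF that] sb[OF that] assms(3) M by (intro mult_mono) auto
    then show "G x * s x \<le> 2 * M" by simp
  qed
  have Gs0: "0 < G x * s x" if "x \<in> {0..T}" for x using Gs[OF that] assms(3) by linarith
  have Y0: "Y x \<ge> 0" for x by (simp add: Y_def)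
  have Q0: "Q x \<ge> 0" if "x \<in> {0..T}" for x using Y0 Gs0[OF that] by (simp add: Q_def)
  have LF: "\<exists>L. L-lipschitz_on {0..T} F"
  proof -
    have "\<exists>L. L-lipschitz_on {0..T} (\<lambda>x. G x * v x + (- l) * (a x * u x))"
      by (intro lipschitz_on_add_ex Lm LG Lv La Lu lipschitz_on_const_ex)
    then have Lz1: "\<exists>L. L-lipschitz_on {0..T} z1" by (simp add: z1_def[abs_def] mult.assoc)
    have "\<exists>L. L-lipschitz_on {0..T} (\<lambda>x. (- l) * (s x * u x))"
      by (intro Lm Ls Lu lipschitz_on_const_ex)
    then have Lz2: "\<exists>L. L-lipschitz_on {0..T} z2" by (simp add: z2_def[abs_def] mult.assoc)
    have "\<exists>L. L-lipschitz_on {0..T} (\<lambda>x. (z1 x * z1 x + z2 x * z2 x) * (1 / (G x * s x)) + 1)"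
      by (intro lipschitz_on_add_ex Lm lipschitz_on_inverse_bounded_below[where m = "m * (1 / 2)"]
          Lz1 Lz2 LG Ls lipschitz_on_const_ex Gs) (use assms(3) in auto)
    then have "\<exists>L. L-lipschitz_on {0..T} (\<lambda>x. Q x + 1)"
      by (simp add: Q_def Y_def power2_eq_square)
    then show ?thesis unfolding F_def[abs_def] by (rule lipschitz_on_ln) (use Q0 in auto)
  qed
  define K where "K = 6 / m * (1 + b2 * (M * b2 + 1))"
  define A where "A x = K * (l * R x + l * \<bar>G x - 1 / c x\<bar>)" for x
  define N' where "N' = N \<union> {0, T}"
  have N': "negligible N'" using N by (simp add: N'_def)
  have dF: "\<exists>D. (F has_real_derivative D) (at x) \<and> D \<le> A x" if x: "x \<in> {0..T} - N'" for x
  proof -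
    have x': "x \<in> {0<..<T} - N" "x \<in> {0..T}" using x by (auto simp: N'_def)
    have at: "at x within {0..T} = at x" using x' by (intro at_within_Icc_at) auto
    show ?thesis
      unfolding F_def[abs_def] Q_def Y_def z1_def z2_def A_def K_def R_def
      by (rule ln_adiabatic_invariant_deriv_bound)
         (use dG[OF x'(2)] da[OF x'(2)] ds[OF x'(2)] du[OF x'(2)] vN[OF x'(1)] cN[OF x'(1)] Gb[OF x'(2)]
            sb[OF x'(2)] assms(2-4) in \<open>auto simp: at\<close>)
  qed
  \<comment> \<open>The bounds on \<open>c\<close> hold only almost everywhere, so positivity is
    read off at a point outside the null set.\<close>
  have b2: "b2 > 0"
  proof -
    have "\<not> {0<..<T} \<subseteq> N"
      using N \<open>0 < T\<close> negligible_subset[of N "{0<..<T}"] open_not_negligible[of "{0<..<T}"] by auto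
    then show ?thesis using cN \<open>0 < b1\<close> by fastforce
  qed
  have K0: "K \<ge> 0" using assms(3) M b2 by (simp add: K_def)
  have A0: "A x \<ge> 0" for x using K0 assms(2) by (simp add: A_def R_def)
  have cR: "continuous_on {0..T} (\<lambda>x. l * R x)"
    unfolding R_def by (intro continuous_intros cG cG' ca ca' cs cs')
  have iR: "(\<lambda>x. l * R x) integrable_on {0..T}" using cR by (rule integrable_continuous_real)
  have si: "set_integrable lebesgue {0<..<T} (\<lambda>x. \<bar>G x - 1 / c x\<bar>)"
    by (rule set_integrable_abs_diff_inverse[OF c cb assms(4) cG, of M]) (use Gb assms(3) in force)
  define W where "W = (LINT x:{0<..<T}|lebesgue. \<bar>G x - 1 / c x\<bar>)"
  have "((\<lambda>x. \<bar>G x - 1 / c x\<bar>) has_integral W) {0<..<T}"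
    using has_integral_set_lebesgue[OF si] by (simp add: W_def)
  then have iW: "((\<lambda>x. \<bar>G x - 1 / c x\<bar>) has_integral W) {0..T}"
    by (simp add: has_integral_Icc_iff_Ioo)
  have iA: "(A has_integral K * (integral {0..T} (\<lambda>x. l * R x) + l * W)) {0..T}"
    unfolding A_def
    by (intro has_integral_mult_right has_integral_add integrable_integral iR iW)
  have Ft: "F t - F 0 \<le> K * (integral {0..T} (\<lambda>x. l * R x) + l * W)"
  proof -
    have t': "0 \<le> t" "{0..t} \<subseteq> {0..T}" using t by auto
    \<comment> \<open>The value \<open>A x\<close> on the null set makes \<open>g\<close> at most
      \<open>A\<close> everywhere, as the comparison of integrals requires.\<close>
    define g where "g x = (if x \<in> N' then A x else vector_derivative F (at x))" for x
    have gA: "g x \<le> A x" if "x \<in> {0..T}" for x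
    proof (cases "x \<in> N'")
      case False
      then have "x \<in> {0..T} - N'" using that by simp
      then obtain D where "(F has_real_derivative D) (at x)" "D \<le> A x" using dF by blast
      then show ?thesis using False
        by (simp add: g_def has_real_derivative_iff_has_vector_derivative vector_derivative_at)
    qed (simp add: g_def)
    obtain L where L: "L-lipschitz_on {0..T} F" using LF by blast
    have "(g has_integral (F t - F 0)) {0..t}"
    proof (rule fundamental_theorem_of_calculus_abs_continuous[OF t'(1) _ N'])
      show "abs_continuous_on_interval 0 t F"
        using lipschitz_on_subset[OF L t'(2)] by (rule lipschitz_imp_abs_continuous_on_interval)
      fix x assume x: "x \<in> {0..t} - N'"
      then obtain D where "(F has_real_derivative D) (at x)" using dF t' by blast
      then show "(F has_vector_derivative g x) (at x within {0..t})"
        using x by (auto simp: g_def has_real_derivative_iff_has_vector_derivative vector_derivative_at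
            intro: has_vector_derivative_at_within)
    qed
    moreover have "A integrable_on {0..t}"
      using iA t' integrable_on_subinterval by blast
    ultimately have "F t - F 0 \<le> integral {0..t} A"
      using gA t' by (intro has_integral_le[OF _ integrable_integral]) auto
    also have "\<dots> \<le> integral {0..T} A"
      using iA t' A0 \<open>A integrable_on {0..t}\<close> by (intro integral_subset_le) auto
    finally show ?thesis using iA by (simp add: integral_unique)
  qed
  have en: "energy l T u x = (v x)\<^sup>2 + (l * u x)\<^sup>2" for x
    by (simp add: energy_def v_def power_mult_distrib)
  \<comment> \<open>\<open>z2\<close> controls \<open>l * u\<close> because \<open>s\<close> is at
    least \<open>1 / 2\<close>; then \<open>G * v = z1 + a * (l * u)\<close> controls
    \<open>v\<close>.\<close>
  have Et: "energy l T u t \<le> (4 + 4 / m\<^sup>2) * Y t"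
  proof -
    have z2: "\<bar>z2 t\<bar> = s t * \<bar>l * u t\<bar>" using sb[OF t] by (simp add: z2_def abs_mult)
    have "\<bar>l * u t\<bar> \<le> 2 * \<bar>z2 t\<bar>"
      unfolding z2 using mult_right_mono[of "1 / 2" "s t" "\<bar>l * u t\<bar>"] sb[OF t] by simp
    then have "\<bar>l * u t\<bar>\<^sup>2 \<le> (2 * \<bar>z2 t\<bar>)\<^sup>2" by (intro power_mono) auto
    then have 1: "(l * u t)\<^sup>2 \<le> 4 * (z2 t)\<^sup>2" by (simp add: power_mult_distrib)
    have "\<bar>a t * (l * u t)\<bar> \<le> \<bar>z2 t\<bar>"
      unfolding z2 abs_mult[of "a t"] using ab[OF t] sb[OF t] by (intro mult_right_mono) auto
    then have 2: "(a t * (l * u t))\<^sup>2 \<le> (z2 t)\<^sup>2" by (simp add: abs_le_square_iff)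
    have "m * \<bar>v t\<bar> \<le> \<bar>G t * v t\<bar>"
      using Gb[OF t] assms(3) by (simp add: abs_mult mult_right_mono)
    then have "(m * \<bar>v t\<bar>)\<^sup>2 \<le> \<bar>G t * v t\<bar>\<^sup>2" using assms(3) by (intro power_mono) auto
    then have "m\<^sup>2 * (v t)\<^sup>2 \<le> (G t * v t)\<^sup>2" by (simp add: power_mult_distrib)
    also have "G t * v t = z1 t + a t * (l * u t)" by (simp add: z1_def)
    also have "(z1 t + a t * (l * u t))\<^sup>2 \<le> 2 * (z1 t)\<^sup>2 + 2 * (a t * (l * u t))\<^sup>2"
      using sum_squares_bound[of "z1 t" "a t * (l * u t)"] by (simp add: power2_sum)
    also have "\<dots> \<le> 2 * (z1 t)\<^sup>2 + 2 * (z2 t)\<^sup>2"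
      by (intro add_left_mono mult_left_mono 2) auto
    also have "\<dots> \<le> 4 * Y t" by (simp add: Y_def)
    finally have "(v t)\<^sup>2 \<le> 4 / m\<^sup>2 * Y t" using assms(3) by (simp add: field_simps)
    moreover have "(l * u t)\<^sup>2 \<le> 4 * Y t" using 1 by (rule order_trans) (simp add: Y_def)
    ultimately show ?thesis by (simp add: en algebra_simps)
  qed
  \<comment> \<open>The number \<open>5\<close> is \<open>2\<close> from \<open>z1\<close> plus
    \<open>3\<close> from \<open>z2\<close>; the factor \<open>2 / m\<close> bounds the inverse of
    \<open>G * s\<close>.\<close>
  have "Q 0 \<le> 2 / m * (2 * M\<^sup>2 + 5)"
  proof -
    have i: "0 \<in> {0..T}" using assms(1) by simp
    have "(z1 0)\<^sup>2 \<le> 2 * (G 0 * v 0)\<^sup>2 + 2 * (a 0 * (l * u 0))\<^sup>2"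
      using sum_squares_bound[of "G 0 * v 0" "- (a 0 * (l * u 0))"] by (simp add: z1_def power2_diff algebra_simps)
    also have "\<dots> = 2 * (G 0)\<^sup>2 * (v 0)\<^sup>2 + 2 * (a 0)\<^sup>2 * (l * u 0)\<^sup>2" by (simp add: power_mult_distrib)
    also have "\<dots> \<le> 2 * M\<^sup>2 * (v 0)\<^sup>2 + 2 * 1 * (l * u 0)\<^sup>2"
    proof (intro add_mono mult_right_mono mult_left_mono)
      show "(G 0)\<^sup>2 \<le> M\<^sup>2" using Gb[OF i] assms(3) by (intro power_mono) auto
      have "\<bar>a 0\<bar>\<^sup>2 \<le> 1\<^sup>2" using ab[OF i] by (intro power_mono) auto
      then show "(a 0)\<^sup>2 \<le> 1" by simp
    qed auto
    finally have 1: "(z1 0)\<^sup>2 \<le> 2 * M\<^sup>2 * (v 0)\<^sup>2 + 2 * (l * u 0)\<^sup>2" by simp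
    have "(s 0)\<^sup>2 \<le> (3/2)\<^sup>2" using sb[OF i] by (intro power_mono) auto
    then have "(s 0)\<^sup>2 \<le> 3" by (simp add: power2_eq_square)
    then have 2: "(z2 0)\<^sup>2 \<le> 3 * (l * u 0)\<^sup>2"
      using mult_right_mono[of "(s 0)\<^sup>2" 3 "(l * u 0)\<^sup>2"] by (simp add: z2_def power_mult_distrib mult_ac)
    have "Y 0 \<le> (2 * M\<^sup>2 * (v 0)\<^sup>2 + 2 * (l * u 0)\<^sup>2) + 3 * (l * u 0)\<^sup>2"
      unfolding Y_def by (intro add_mono 1 2)
    also have "\<dots> \<le> (2 * M\<^sup>2 + 5) * energy l T u 0" by (simp add: en algebra_simps)
    also have "\<dots> \<le> (2 * M\<^sup>2 + 5) * 1" using e0 by (intro mult_left_mono) auto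
    finally have "Y 0 \<le> 2 * M\<^sup>2 + 5" by simp
    then have "Q 0 \<le> (2 * M\<^sup>2 + 5) / (m * (1 / 2))"
      unfolding Q_def using Gs[OF i] Y0 assms(3) by (intro frac_le) auto
    then show ?thesis by simp
  qed
  note Q00 = this
  have "energy l T u t \<le> (4 + 4 / m\<^sup>2) * (G t * s t * Q t)"
  proof -
    have "G t * s t \<noteq> 0" using Gs0[OF t] by (metis less_irrefl)
    then have "Y t = G t * s t * Q t" by (metis Q_def nonzero_mult_div_cancel_left times_divide_eq_right)
    then show ?thesis using Et by simp
  qed
  also have "\<dots> \<le> (4 + 4 / m\<^sup>2) * (2 * M * (Q t + 1))"
    using Gs[OF t] Q0[OF t] M by (intro mult_left_mono mult_mono[of "G t * s t"]) auto
  also have "Q t + 1 = exp (F t)" using Q0[OF t] by (simp add: F_def)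
  also have "(4 + 4 / m\<^sup>2) * (2 * M * exp (F t)) \<le> (4 + 4 / m\<^sup>2) * (2 * M * ((2 / m * (2 * M\<^sup>2 + 5) + 1) *
      exp (K * (integral {0..T} (\<lambda>x. l * R x) + l * W))))"
  proof (intro mult_left_mono)
    have "exp (F t) \<le> exp (F 0) * exp (K * (integral {0..T} (\<lambda>x. l * R x) + l * W))"
      using Ft by (simp add: exp_add[symmetric])
    also have "exp (F 0) = Q 0 + 1" using Q0[of 0] assms(1) by (simp add: F_def)
    also have "(Q 0 + 1) * exp (K * (integral {0..T} (\<lambda>x. l * R x) + l * W)) \<le>
        (2 / m * (2 * M\<^sup>2 + 5) + 1) * exp (K * (integral {0..T} (\<lambda>x. l * R x) + l * W))"
      using Q00 by (intro mult_right_mono) auto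
    finally show "exp (F t) \<le> (2 / m * (2 * M\<^sup>2 + 5) + 1) *
        exp (K * (integral {0..T} (\<lambda>x. l * R x) + l * W))" .
  qed (use M in auto)
  finally show ?thesis unfolding K_def W_def by (simp only: mult.assoc)
qed

section \<open>The growth bound\<close>

text \<open>On an interval of length \<open>h\<close> that is balanced or less, the jets obey
  geometric bounds with ratio \<open>\<eta> h\<close>, so the residual is at most a multiple of
  \<open>\<eta> h ^ k\<close> plus the top derivative. Balance turns the first contribution into the
  second; when \<open>{0..T}\<close> itself falls short of balance, the first contribution is the
  additive \<open>1\<close>. The variable \<open>J\<close> merely abbreviates the rescaled
  jet.\<close>

lemma wkb_residual_integral_bound:
  assumes "1 \<le> k" and "0 \<le> M"
  shows "\<exists>\<epsilon>>0. \<exists>C\<ge>0. \<forall>T l (g :: nat \<Rightarrow> real \<Rightarrow> real) J. 0 < T \<longrightarrow> 0 < l \<longrightarrow>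
     (\<forall>i<k. \<forall>x\<in>{0..T}. (g i has_real_derivative g (Suc i) x) (at x within {0..T})) \<longrightarrow>
     continuous_on {0..T} (g k) \<longrightarrow> (\<forall>x\<in>{0..T}. \<bar>g 0 x\<bar> \<le> M) \<longrightarrow>
     (\<forall>j\<in>{1..k - 1}. \<forall>x\<in>{0..T}. \<bar>g j x\<bar> \<le> \<epsilon> * l ^ j) \<longrightarrow>
     J = (\<lambda>x j. complex_of_real (g j x / l ^ j)) \<longrightarrow>
     (\<forall>x\<in>{0..T}. norm (wkb (J x) (k - 1) 0) \<le> 1 / 2) \<and>
     integral {0..T} (\<lambda>x. l * (2 * norm (wkb (J x) k 0 - wkb (J x) (k - 1) 0)))
       \<le> C * (1 + 1 / l ^ (k - 1) * integral {0..T} (\<lambda>x. \<bar>g k x\<bar>))"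
proof -
  obtain Ci where Ci: "Ci \<ge> 0" and interp: "\<And>(g :: nat \<Rightarrow> real \<Rightarrow> real) a b. a < b \<Longrightarrow>
     (\<forall>i<k. \<forall>x\<in>{a..b}. (g i has_real_derivative g (Suc i) x) (at x within {a..b})) \<Longrightarrow>
     continuous_on {a..b} (g k) \<Longrightarrow> (\<forall>x\<in>{a..b}. \<bar>g 0 x\<bar> \<le> M) \<Longrightarrow>
     (b - a) ^ (k - 1) * integral {a..b} (\<lambda>x. \<bar>g k x\<bar>) \<le> 1 \<Longrightarrow>
     (\<forall>j<k. \<forall>x\<in>{a..b}. \<bar>g j x\<bar> \<le> Ci / (b - a) ^ j)"
    using interpolation_bound[OF assms] by blast
  define B where "B = 1 + M + Ci"
  have B: "B \<ge> 1" "M \<le> B" "Ci \<le> B" using Ci assms by (auto simp: B_def)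
  obtain C where C: "C \<ge> 0" and bd: "\<And>G \<eta>. 0 \<le> \<eta> \<Longrightarrow> \<eta> \<le> 1 \<Longrightarrow> (\<forall>j<k. norm (G j) \<le> B * \<eta> ^ j) \<Longrightarrow>
     norm (wkb G k 0 - wkb G (k - 1) 0) \<le> C * (\<eta> ^ k + norm (G k)) \<and> norm (wkb G (k - 1) 0) \<le> C * \<eta>"
    using wkb_pointwise_bounds[OF assms(1) B(1)] by blast
  \<comment> \<open>Chosen so that weights of ratio \<open>\<eta>0\<close> force the iterate below
    \<open>1 / 2\<close>.\<close>
  define \<eta>0 where "\<eta>0 = 1 / (2 * C + 1)"
  have \<eta>0: "0 < \<eta>0" "\<eta>0 \<le> 1" "C * \<eta>0 \<le> 1 / 2" using C by (auto simp: \<eta>0_def field_simps)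
  \<comment> \<open>The power \<open>k\<close> ensures that \<open>\<epsilon>\<close> is at most
    \<open>\<eta>0 ^ j\<close> for every order \<open>j\<close> below \<open>k\<close>.\<close>
  define \<epsilon> where "\<epsilon> = \<eta>0 ^ k"
  have \<epsilon>: "\<epsilon> > 0" "\<epsilon> \<le> 1" using \<eta>0 by (auto simp: \<epsilon>_def power_le_one)
  show ?thesis
  \<comment> \<open>In \<open>8 * C\<close>, a factor \<open>2 * C\<close> comes from the pointwise
    bound on \<open>f\<close>, another \<open>2\<close> from absorbing the length term by balance,
    and the last \<open>2\<close> from the overlap of the cover.\<close>
  proof (rule exI[of _ \<epsilon>], rule conjI[OF \<epsilon>(1)], rule exI[of _ "8 * C"], rule conjI, use C in simp,
      intro allI impI, rule conjI)
    fix T l :: real and g :: "nat \<Rightarrow> real \<Rightarrow> real" and J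
    assume T: "0 < T" and l: "0 < l"
      and der: "\<forall>i<k. \<forall>x\<in>{0..T}. (g i has_real_derivative g (Suc i) x) (at x within {0..T})"
      and cont: "continuous_on {0..T} (g k)" and gM: "\<forall>x\<in>{0..T}. \<bar>g 0 x\<bar> \<le> M"
      and g\<epsilon>: "\<forall>j\<in>{1..k - 1}. \<forall>x\<in>{0..T}. \<bar>g j x\<bar> \<le> \<epsilon> * l ^ j"
      and J: "J = (\<lambda>x j. complex_of_real (g j x / l ^ j))"
    have nJ: "norm (J x j) = \<bar>g j x\<bar> / l ^ j" for x j using l by (simp add: J norm_divide norm_power)
    have J\<epsilon>: "norm (J x j) \<le> \<epsilon>" if "1 \<le> j" "j < k" "x \<in> {0..T}" for x j
      using g\<epsilon> that l by (simp add: nJ field_simps)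
    have J0: "norm (J x 0) \<le> B" if "x \<in> {0..T}" for x
      using gM that B by (force simp: nJ)
    show "\<forall>x\<in>{0..T}. norm (wkb (J x) (k - 1) 0) \<le> 1 / 2"
    proof
      fix x assume x: "x \<in> {0..T}"
      have "norm (wkb (J x) (k - 1) 0) \<le> C * \<eta>0"
      proof (rule bd[THEN conjunct2])
        show "\<forall>j<k. norm (J x j) \<le> B * \<eta>0 ^ j"
        proof (intro allI impI)
          fix j assume j: "j < k"
          show "norm (J x j) \<le> B * \<eta>0 ^ j"
          proof (cases "j = 0")
            case False
            then have "norm (J x j) \<le> \<epsilon>" using J\<epsilon> j x by simp
            also have "\<dots> \<le> \<eta>0 ^ j" unfolding \<epsilon>_def using \<eta>0 j by (intro power_decreasing) auto
            also have "\<dots> \<le> B * \<eta>0 ^ j" using B \<eta>0 by simp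
            finally show ?thesis .
          qed (use J0 x in simp)
        qed
      qed (use \<eta>0 in auto)
      then show "norm (wkb (J x) (k - 1) 0) \<le> 1 / 2" using \<eta>0 by linarith
    qed
    define f where "f x = l * (2 * norm (wkb (J x) k 0 - wkb (J x) (k - 1) 0))" for x
    have cg: "continuous_on {0..T} (g j)" if "j \<le> k" for j
      using that der cont DERIV_continuous_on[of "{0..T}" "g j" "g (Suc j)"] by (cases "j = k") auto
    have cJ: "continuous_on {0..T} (\<lambda>x. J x j)" if "j \<le> k" for j
      unfolding J using cg[OF that] l by (intro continuous_intros) auto
    have cf: "continuous_on {0..T} f"
      unfolding f_def by (intro continuous_intros continuous_on_wkb[of _ _ _ "\<lambda>j x. J x j", simplified] cJ) auto
    have f0: "f x \<ge> 0" for x using l by (simp add: f_def)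
    have intg: "(\<lambda>x. \<bar>g k x\<bar>) integrable_on {a..b}" if "0 \<le> a" "b \<le> T" for a b
      using that by (intro integrable_continuous_real continuous_intros continuous_on_subset[OF cont]) auto
    \<comment> \<open>Two regimes: if \<open>l * h\<close> is at most \<open>1\<close>, the
      derivative constraints with \<open>\<epsilon> \<le> 1\<close> already give ratio
      \<open>1\<close>; on longer intervals interpolation gives the ratio
      \<open>1 / (l * h)\<close>.\<close>
    define \<eta> where "\<eta> h = min 1 (1 / (l * h))" for h
    have loc: "integral {a..b} f \<le> 2 * C * ((b - a) * l * \<eta> (b - a) ^ k
        + 1 / l ^ (k - 1) * integral {a..b} (\<lambda>x. \<bar>g k x\<bar>))"
      if ab: "0 \<le> a" "a < b" "b \<le> T" and int: "(b - a) ^ (k - 1) * integral {a..b} (\<lambda>x. \<bar>g k x\<bar>) \<le> 1" for a b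
    proof -
      define h where "h = b - a"
      have h: "h > 0" using ab by (simp add: h_def)
      have \<eta>: "0 \<le> \<eta> h" "\<eta> h \<le> 1" using h l by (auto simp: \<eta>_def)
      have sub: "{a..b} \<subseteq> {0..T}" using ab by auto
      have "\<forall>j<k. \<forall>x\<in>{a..b}. \<bar>g j x\<bar> \<le> Ci / (b - a) ^ j"
      proof (rule interp[where g = g and a = a and b = b, OF ab(2) _ _ _ int])
        show "\<forall>i<k. \<forall>x\<in>{a..b}. (g i has_real_derivative g (Suc i) x) (at x within {a..b})"
          using sub der by (blast intro: DERIV_subset[OF _ sub])
        show "continuous_on {a..b} (g k)" using cont sub by (rule continuous_on_subset)
      qed (use sub gM in auto)
      then have gC: "\<bar>g j x\<bar> \<le> Ci / h ^ j" if "j < k" "x \<in> {a..b}" for j x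
        using that by (simp add: h_def)
      have pt: "f x \<le> 2 * C * (l * \<eta> h ^ k + 1 / l ^ (k - 1) * \<bar>g k x\<bar>)" if x: "x \<in> {a..b}" for x
      proof -
        have "norm (wkb (J x) k 0 - wkb (J x) (k - 1) 0) \<le> C * (\<eta> h ^ k + norm (J x k))"
        proof (rule bd[OF \<eta>, THEN conjunct1], intro allI impI)
          fix j assume j: "j < k"
          show "norm (J x j) \<le> B * \<eta> h ^ j"
          proof (cases "1 \<le> 1 / (l * h)")
            case True
            then have "\<eta> h = 1" by (simp add: \<eta>_def)
            moreover have "norm (J x j) \<le> B"
              using J\<epsilon>[of j x] J0[of x] j x sub \<epsilon> B by (cases "j = 0") force+
            ultimately show ?thesis by simp
          next
            case False
            then have e: "\<eta> h = 1 / (l * h)" by (simp add: \<eta>_def)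
            have "norm (J x j) \<le> (Ci / h ^ j) / l ^ j"
              unfolding nJ using gC[OF j x] l by (intro divide_right_mono) auto
            also have "\<dots> = Ci * \<eta> h ^ j" by (simp add: e power_divide power_mult_distrib mult.commute)
            also have "\<dots> \<le> B * \<eta> h ^ j" using B \<eta> by (intro mult_right_mono) auto
            finally show ?thesis .
          qed
        qed
        then have "f x \<le> l * (2 * (C * (\<eta> h ^ k + norm (J x k))))"
          unfolding f_def using l by (intro mult_left_mono) auto
        also have "\<dots> = 2 * C * (l * \<eta> h ^ k + l * norm (J x k))" by (simp add: algebra_simps)
        also have "l * norm (J x k) = 1 / l ^ (k - 1) * \<bar>g k x\<bar>"
          using l assms(1) by (cases k) (auto simp: nJ field_simps)
        finally show ?thesis .
      qed
      have "integral {a..b} f \<le> integral {a..b} (\<lambda>x. 2 * C * (l * \<eta> h ^ k + 1 / l ^ (k - 1) * \<bar>g k x\<bar>))"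
        using sub cont
        by (intro integral_le integrable_continuous_real continuous_on_subset[OF cf] pt continuous_intros)
           (auto intro: continuous_on_subset)
      also have "\<dots> = 2 * C * (h * (l * \<eta> h ^ k) + 1 / l ^ (k - 1) * integral {a..b} (\<lambda>x. \<bar>g k x\<bar>))"
      proof -
        have "((\<lambda>x. 2 * C * (l * \<eta> h ^ k + 1 / l ^ (k - 1) * \<bar>g k x\<bar>)) has_integral
           2 * C * (measure lborel {a..b} *\<^sub>R (l * \<eta> h ^ k) + 1 / l ^ (k - 1) * integral {a..b} (\<lambda>x. \<bar>g k x\<bar>))) {a..b}"
          by (intro has_integral_mult_right has_integral_add has_integral_const_real integrable_integral intg ab)
        from integral_unique[OF this] show ?thesis using ab by (simp add: h_def)
      qed
      finally show ?thesis by (simp add: h_def mult.assoc)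
    qed
    define I where "I = integral {0..T} (\<lambda>x. \<bar>g k x\<bar>)"
    have I0: "I \<ge> 0" unfolding I_def by (intro integral_nonneg intg) auto
    have "integral {0..T} f \<le> 8 * C * (1 + 1 / l ^ (k - 1) * I)"
    proof (cases "1 \<le> (T - 0) ^ (k - 1) * integral {0..T} (\<lambda>x. \<bar>g k x\<bar>)")
      case True
      have "integral {0..T} f \<le> 2 * (4 * C / l ^ (k - 1)) * integral {0..T} (\<lambda>x. \<bar>g k x\<bar>)"
      proof (rule integral_le_by_balanced_intervals[OF cf _ f0 _ assms(1) _ _ _ True])
        show "continuous_on {0..T} (\<lambda>x. \<bar>g k x\<bar>)" using cont by (intro continuous_intros)
        show "0 \<le> 4 * C / l ^ (k - 1)" using C l by simp
        fix a b assume ab: "0 \<le> a" "a < b" "b \<le> T"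
          and bal: "(b - a) ^ (k - 1) * integral {a..b} (\<lambda>x. \<bar>g k x\<bar>) = 1"
        define h where "h = b - a"
        have h: "h > 0" using ab by (simp add: h_def)
        have "\<eta> h ^ k \<le> (1 / (l * h)) ^ k"
          using h l by (intro power_mono) (auto simp: \<eta>_def)
        \<comment> \<open>By balance, the remaining power \<open>1 / h ^ (k - 1)\<close> is exactly
          the integral of the top derivative.\<close>
        then have "h * l * \<eta> h ^ k \<le> h * l * (1 / (l * h)) ^ k"
          using h l by (intro mult_left_mono) auto
        also have "\<dots> = 1 / l ^ (k - 1) * (1 / h ^ (k - 1))"
          using h l assms(1) by (cases k) (auto simp: power_divide power_mult_distrib)
        also have "1 / h ^ (k - 1) = integral {a..b} (\<lambda>x. \<bar>g k x\<bar>)"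
          using bal h by (simp add: h_def field_simps)
        finally have "h * l * \<eta> h ^ k + 1 / l ^ (k - 1) * integral {a..b} (\<lambda>x. \<bar>g k x\<bar>)
            \<le> 2 * (1 / l ^ (k - 1) * integral {a..b} (\<lambda>x. \<bar>g k x\<bar>))" by simp
        then have "2 * C * (h * l * \<eta> h ^ k + 1 / l ^ (k - 1) * integral {a..b} (\<lambda>x. \<bar>g k x\<bar>))
            \<le> 2 * C * (2 * (1 / l ^ (k - 1) * integral {a..b} (\<lambda>x. \<bar>g k x\<bar>)))"
          using C by (intro mult_left_mono) auto
        then show "integral {a..b} f \<le> 4 * C / l ^ (k - 1) * integral {a..b} (\<lambda>x. \<bar>g k x\<bar>)"
          using loc[OF ab] bal by (simp add: h_def)
      qed (use T in auto)
      also have "\<dots> = 8 * C * (1 / l ^ (k - 1) * I)" by (simp add: I_def)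
      also have "\<dots> \<le> 8 * C * (1 + 1 / l ^ (k - 1) * I)" using C by (intro mult_left_mono) auto
      finally show ?thesis .
    next
      case False
      \<comment> \<open>Here the whole of \<open>{0..T}\<close> qualifies for \<open>loc\<close>,
        and one power of \<open>\<eta> T\<close> already bounds the length term by
        \<open>1\<close>.\<close>
      have e: "0 \<le> \<eta> T" "\<eta> T \<le> 1" "\<eta> T \<le> 1 / (l * T)" using T l by (auto simp: \<eta>_def)
      have "\<eta> T ^ k \<le> \<eta> T ^ 1" using e assms(1) by (intro power_decreasing) auto
      then have "T * l * \<eta> T ^ k \<le> T * l * (1 / (l * T))"
        using e T l by (intro mult_left_mono) auto
      also have "\<dots> = 1" using T l by simp
      finally have "2 * C * (T * l * \<eta> T ^ k + 1 / l ^ (k - 1) * I) \<le> 2 * C * (1 + 1 / l ^ (k - 1) * I)"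
        using C by (intro mult_left_mono) auto
      moreover have "integral {0..T} f \<le> 2 * C * (T * l * \<eta> T ^ k + 1 / l ^ (k - 1) * I)"
        using loc[of 0 T] T False by (simp add: I_def)
      moreover have "2 * C * (1 + 1 / l ^ (k - 1) * I) \<le> 8 * C * (1 + 1 / l ^ (k - 1) * I)"
        using C I0 l by (intro mult_right_mono) auto
      ultimately show ?thesis by linarith
    qed
    then show "integral {0..T} (\<lambda>x. l * (2 * norm (wkb (J x) k 0 - wkb (J x) (k - 1) 0)))
       \<le> 8 * C * (1 + 1 / l ^ (k - 1) * integral {0..T} (\<lambda>x. \<bar>g k x\<bar>))"
      by (simp only: f_def[abs_def] I_def)
  qed
qed

section \<open>Admissible functions and the estimate for a single competitor\<close>

lemma Ck_onD:
  assumes "Ck_on k f S" and "j < k" and "x \<in> S"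
  shows "(higher_deriv_on S j f has_real_derivative higher_deriv_on S (Suc j) f x) (at x within S)"
proof -
  have "higher_deriv_on S j f differentiable (at x within S)"
    using assms unfolding Ck_on_def differentiable_on_def by auto
  then show ?thesis
    by (simp add: has_real_derivative_iff_has_vector_derivative vector_derivative_works
        higher_deriv_on_def deriv_on_def)
qed

text \<open>Guarantees that the infimum is over a nonempty set. The induction speaks only of points
  of \<open>{0..T}\<close>, since the values of \<open>deriv_on\<close> elsewhere are unspecified;
  \<open>0 < T\<close> makes the one-sided derivatives unique.\<close>

lemma const_admissible:
  assumes "0 < T" "0 \<le> e" "0 < l" "m1 \<le> m2"
  shows "(\<lambda>x. m1) \<in> admissible m1 m2 e k T l"
proof -
  define d where "d j = higher_deriv_on {0..T} j (\<lambda>x. m1)" for j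
  have dSuc: "d (Suc j) x = vector_derivative (d j) (at x within {0..T})" for j x
    by (simp add: d_def higher_deriv_on_def deriv_on_def)
  have d0: "d 0 = (\<lambda>x. m1)" by (simp add: d_def higher_deriv_on_def)
  have vd: "(d j has_vector_derivative 0) (at x within {0..T}) \<and> d (Suc j) x = 0" if x: "x \<in> {0..T}" for j x
    using x
  proof (induction j arbitrary: x)
    case 0
    have "(d 0 has_vector_derivative 0) (at x within {0..T})" by (simp add: d0)
    then show ?case
      using vector_derivative_within_cbox[of 0 T x "d 0" 0] 0 assms(1) by (simp add: dSuc)
  next
    case (Suc j)
    have "(d (Suc j) has_vector_derivative 0) (at x within {0..T})"
      by (rule has_vector_derivative_transform[OF Suc.prems _ has_vector_derivative_const[of 0]])
         (use Suc.IH in auto)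
    moreover from this have "vector_derivative (d (Suc j)) (at x within {0..T}) = 0"
      using vector_derivative_within_cbox[of 0 T x "d (Suc j)" 0] Suc.prems assms(1) by simp
    then have "d (Suc (Suc j)) x = 0" by (simp only: dSuc[of "Suc j"])
    ultimately show ?case by blast
  qed
  have "continuous_on {0..T} (d k)"
    using vd by (intro continuous_on_vector_derivative) blast
  moreover have "d j differentiable_on {0..T}" for j
    using vd unfolding differentiable_on_def by (blast intro: differentiableI_vector)
  moreover have "d j x = 0" if "1 \<le> j" "x \<in> {0..T}" for j x
    using vd[of x "j - 1"] that by simp
  ultimately show ?thesis
    using assms by (auto simp: admissible_def Ck_on_def d_def)
qed

text \<open>Translates between the complex residual and the pair \<open>r1\<close>,
  \<open>r2\<close> of the adiabatic estimate, with \<open>a = Re p\<close> and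
  \<open>s = 1 + Im p\<close>.\<close>

lemma wkb_real_residual:
  fixes j0 j1 :: real and p p' :: complex
  shows "sqrt ((j0 * Re p' - Re p * j1 + (Re p)\<^sup>2 - (1 + Im p)\<^sup>2 + 1)\<^sup>2
        + (j0 * Im p' - (1 + Im p) * j1 + 2 * Re p * (1 + Im p))\<^sup>2)
     = norm (of_real j0 * p' - (\<i> + p) * of_real j1 + 2 * \<i> * p + p\<^sup>2)"
  unfolding cmod_def
  by (rule arg_cong[where f = sqrt], rule arg_cong2[where f = "(+)"]; rule arg_cong[where f = "\<lambda>x. x\<^sup>2"])
     (simp_all add: power2_eq_square algebra_simps)

text \<open>Combines \<open>wkb_residual_integral_bound\<close> with \<open>energy_bound\<close> for
  a fixed competitor. The purely exponential form is what later permits taking the supremum, the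
  logarithm and the infimum, in this order.\<close>

lemma energy_admissible_bound:
  assumes "0 < \<nu>1" and "\<nu>1 \<le> \<nu>2" and "1 \<le> k"
  shows "\<exists>\<epsilon>>0. \<exists>C>0. \<forall>T>0. \<forall>c \<in> borel_measurable (lebesgue_on {0<..<T}).
           (AE t in lebesgue_on {0<..<T}. \<nu>1 \<le> c t \<and> c t \<le> \<nu>2) \<longrightarrow>
           (\<forall>l>0. \<forall>\<gamma>\<in>admissible (1 / \<nu>2) (1 / \<nu>1) \<epsilon> k T l. \<forall>u. \<forall>t\<in>{0..T}.
             wave_solution c l T u \<longrightarrow> energy l T u 0 \<le> 1 \<longrightarrow>
             energy l T u t \<le> exp (C * (1 +
               (1 / l ^ (k - 1) * (LINT x:{0<..<T}|lebesgue. \<bar>higher_deriv_on {0..T} k \<gamma> x\<bar>) +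
                l * (LINT x:{0<..<T}|lebesgue. \<bar>\<gamma> x - 1 / c x\<bar>)))))"
proof -
  define m where "m = 1 / \<nu>2"
  define M where "M = 1 / \<nu>1"
  have m: "0 < m" "0 < M" using assms by (auto simp: m_def M_def)
  obtain \<epsilon> C where \<epsilon>: "\<epsilon> > 0" and C: "C \<ge> 0" and res: "\<And>T l (g :: nat \<Rightarrow> real \<Rightarrow> real) J. 0 < T \<Longrightarrow> 0 < l \<Longrightarrow>
     (\<forall>i<k. \<forall>x\<in>{0..T}. (g i has_real_derivative g (Suc i) x) (at x within {0..T})) \<Longrightarrow>
     continuous_on {0..T} (g k) \<Longrightarrow> (\<forall>x\<in>{0..T}. \<bar>g 0 x\<bar> \<le> M) \<Longrightarrow>
     (\<forall>j\<in>{1..k - 1}. \<forall>x\<in>{0..T}. \<bar>g j x\<bar> \<le> \<epsilon> * l ^ j) \<Longrightarrow>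
     J = (\<lambda>x j. complex_of_real (g j x / l ^ j)) \<Longrightarrow>
     (\<forall>x\<in>{0..T}. norm (wkb (J x) (k - 1) 0) \<le> 1 / 2) \<and>
     integral {0..T} (\<lambda>x. l * (2 * norm (wkb (J x) k 0 - wkb (J x) (k - 1) 0)))
       \<le> C * (1 + 1 / l ^ (k - 1) * integral {0..T} (\<lambda>x. \<bar>g k x\<bar>))"
    using wkb_residual_integral_bound[OF assms(3) less_imp_le[OF m(2)]] by blast
  define K0 where "K0 = (4 + 4 / m\<^sup>2) * (2 * M) * (2 / m * (2 * M\<^sup>2 + 5) + 1)"
  define K where "K = 6 / m * (1 + \<nu>2 * (M * \<nu>2 + 1))"
  have K0: "K0 > 0" unfolding K0_def using m by (intro mult_pos_pos add_pos_nonneg add_nonneg_pos) auto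
  have K: "K > 0" unfolding K_def using m assms by (intro mult_pos_pos add_pos_nonneg) auto
  \<comment> \<open>\<open>\<bar>ln K0\<bar>\<close> moves the prefactor into the exponent, where
    the summand \<open>1\<close> pays for it; \<open>C + 1\<close> dominates the coefficients of
    both integrals.\<close>
  define CC where "CC = \<bar>ln K0\<bar> + K * (C + 1)"
  have CC: "CC > 0" using K C by (simp add: CC_def add_nonneg_pos)
  show ?thesis
  proof (rule exI[of _ \<epsilon>], rule conjI[OF \<epsilon>], rule exI[of _ CC], rule conjI[OF CC], intro allI impI ballI)
    fix T :: real and c l \<gamma> u t
    assume T: "0 < T" and c: "c \<in> borel_measurable (lebesgue_on {0<..<T})"
      and cb: "AE t in lebesgue_on {0<..<T}. \<nu>1 \<le> c t \<and> c t \<le> \<nu>2" and l: "0 < l"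
      and \<gamma>: "\<gamma> \<in> admissible (1 / \<nu>2) (1 / \<nu>1) \<epsilon> k T l" and t: "t \<in> {0..T}"
      and u: "wave_solution c l T u" and e0: "energy l T u 0 \<le> 1"
    define g where "g j = higher_deriv_on {0..T} j \<gamma>" for j
    define J where "J = (\<lambda>x j. complex_of_real (g j x / l ^ j))"
    have g0: "g 0 = \<gamma>" by (simp add: g_def higher_deriv_on_def)
    have Ck: "Ck_on k \<gamma> {0..T}" and \<gamma>b: "\<And>x. x \<in> {0..T} \<Longrightarrow> m \<le> \<gamma> x \<and> \<gamma> x \<le> M"
      and g\<epsilon>: "\<forall>j\<in>{1..k - 1}. \<forall>x\<in>{0..T}. \<bar>g j x\<bar> \<le> \<epsilon> * l ^ j"
      using \<gamma> unfolding admissible_def g_def m_def M_def by blast+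
    have der: "(g i has_real_derivative g (Suc i) x) (at x within {0..T})" if "i < k" "x \<in> {0..T}" for i x
      using Ck_onD[OF Ck that] by (simp add: g_def)
    have cont: "continuous_on {0..T} (g k)" using Ck by (simp add: Ck_on_def g_def)
    have "\<forall>x\<in>{0..T}. \<bar>g 0 x\<bar> \<le> M" using \<gamma>b m by (force simp: g0)
    then have R: "\<forall>x\<in>{0..T}. norm (wkb (J x) (k - 1) 0) \<le> 1 / 2"
      "integral {0..T} (\<lambda>x. l * (2 * norm (wkb (J x) k 0 - wkb (J x) (k - 1) 0)))
       \<le> C * (1 + 1 / l ^ (k - 1) * integral {0..T} (\<lambda>x. \<bar>g k x\<bar>))"
      using res[OF T l _ cont _ g\<epsilon> J_def] der by auto
    have cg: "continuous_on {0..T} (g j)" if "j \<le> k" for j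
      using that der cont DERIV_continuous_on[of "{0..T}" "g j" "g (Suc j)"] by (cases "j = k") auto
    have cJ: "continuous_on {0..T} (\<lambda>x. J x j)" if "j \<le> k" for j
      unfolding J_def using cg[OF that] l by (intro continuous_intros) auto
    have dJ: "((\<lambda>x. J x j) has_vector_derivative of_real l * J x (Suc j)) (at x within {0..T})"
      if "j < k" "x \<in> {0..T}" for j x
    proof -
      have "((\<lambda>x. g j x / l ^ j) has_real_derivative g (Suc j) x / l ^ j) (at x within {0..T})"
        using der[OF that] by (rule DERIV_cdivide)
      then have "((\<lambda>x. complex_of_real (g j x / l ^ j)) has_vector_derivative
          of_real (g (Suc j) x / l ^ j)) (at x within {0..T})"
        unfolding has_real_derivative_iff_has_vector_derivative by (rule bounded_linear.has_vector_derivative[OF bounded_linear_of_real])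
      moreover have "complex_of_real (g (Suc j) x / l ^ j) = of_real l * J x (Suc j)"
        using l by (simp add: J_def)
      ultimately show ?thesis by (simp add: J_def)
    qed
    define p where "p x = wkb (J x) (k - 1) 0" for x
    define p' where "p' x = wkb (J x) (k - 1) 1" for x
    have dp: "(p has_vector_derivative of_real l * p' x) (at x within {0..T})" if "x \<in> {0..T}" for x
      using has_vector_derivative_wkb[of "k - 1" 0 "\<lambda>j x. J x j" l x "{0..T}"] dJ that assms(3)
      by (simp add: p_def[abs_def] p'_def)
    have cp': "continuous_on {0..T} p'"
      using continuous_on_wkb[of "k - 1" 1 "{0..T}" "\<lambda>j x. J x j"] cJ assms(3)
      by (simp add: p'_def[abs_def])
    have pb: "\<bar>Re (p x)\<bar> \<le> 1 / 2" "\<bar>Im (p x)\<bar> \<le> 1 / 2" if "x \<in> {0..T}" for x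
      using R(1) that abs_Re_le_cmod[of "p x"] abs_Im_le_cmod[of "p x"] unfolding p_def by fastforce+
    define G' where "G' x = g 1 x / l" for x
    have res_eq: "sqrt ((\<gamma> x * Re (p' x) - Re (p x) * G' x + (Re (p x))\<^sup>2 - (1 + Im (p x))\<^sup>2 + 1)\<^sup>2
        + (\<gamma> x * Im (p' x) - (1 + Im (p x)) * G' x + 2 * Re (p x) * (1 + Im (p x)))\<^sup>2)
        = 2 * norm (wkb (J x) k 0 - wkb (J x) (k - 1) 0)" for x
    proof -
      have "of_real (\<gamma> x) * p' x - (\<i> + p x) * of_real (G' x) + 2 * \<i> * p x + (p x)\<^sup>2
          = - 2 * \<i> * (wkb (J x) (Suc (k - 1)) 0 - wkb (J x) (k - 1) 0)"
        using wkb_residual[of "J x" "k - 1"] by (simp add: p_def p'_def J_def g0 G'_def del: wkb.simps)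
      then show ?thesis using assms(3) unfolding wkb_real_residual by (simp add: norm_mult)
    qed
    define A where "A = 1 / l ^ (k - 1) * integral {0..T} (\<lambda>x. \<bar>g k x\<bar>)"
    define W where "W = l * (LINT x:{0<..<T}|lebesgue. \<bar>\<gamma> x - 1 / c x\<bar>)"
    have "energy l T u t \<le> K0 * exp (K * (integral {0..T} (\<lambda>x. l *
        sqrt ((\<gamma> x * Re (p' x) - Re (p x) * G' x + (Re (p x))\<^sup>2 - (1 + Im (p x))\<^sup>2 + 1)\<^sup>2
        + (\<gamma> x * Im (p' x) - (1 + Im (p x)) * G' x + 2 * Re (p x) * (1 + Im (p x)))\<^sup>2)) + W))"
      unfolding K0_def K_def W_def
    proof (rule energy_bound[OF T l m(1) assms(1) \<gamma>b])
      fix x assume x: "x \<in> {0..T}"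
      show "\<bar>Re (p x)\<bar> \<le> 1 / 2" using pb x by blast
      show "1 / 2 \<le> 1 + Im (p x) \<and> 1 + Im (p x) \<le> 3 / 2" using pb(2)[OF x] by linarith
      show "(\<gamma> has_real_derivative l * G' x) (at x within {0..T})"
        using der[of 0 x] x assms(3) l by (simp add: g0 G'_def)
      show "((\<lambda>x. Re (p x)) has_real_derivative l * Re (p' x)) (at x within {0..T})"
        using bounded_linear.has_vector_derivative[OF bounded_linear_Re dp[OF x]]
        by (simp add: has_real_derivative_iff_has_vector_derivative)
      have "((\<lambda>x. Im (p x)) has_real_derivative l * Im (p' x)) (at x within {0..T})"
        using bounded_linear.has_vector_derivative[OF bounded_linear_Im dp[OF x]]
        by (simp add: has_real_derivative_iff_has_vector_derivative)
      from DERIV_add[OF DERIV_const this, of 1]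
      show "((\<lambda>x. 1 + Im (p x)) has_real_derivative l * Im (p' x)) (at x within {0..T})" by simp
    next
      show "continuous_on {0..T} G'"
        unfolding G'_def using cg[of 1] assms(3) l by (intro continuous_intros) auto
    qed (use cp' c cb u e0 t in \<open>auto intro: continuous_intros\<close>)
    also have "\<dots> \<le> K0 * exp (K * (C * (1 + A) + W))"
      using R(2) K K0 unfolding res_eq A_def by (intro mult_left_mono) auto
    also have "\<dots> = exp (ln K0 + K * (C * (1 + A) + W))" using K0 by (simp add: exp_add)
    also have "\<dots> \<le> exp (CC * (1 + (A + W)))"
    proof -
      have A0: "0 \<le> A"
        unfolding A_def using l cont
        by (intro mult_nonneg_nonneg integral_nonneg integrable_continuous_real continuous_intros) auto
      have W0: "0 \<le> W"
        unfolding W_def set_lebesgue_integral_def using l by (intro mult_nonneg_nonneg integral_nonneg_AE) auto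
      have "ln K0 \<le> \<bar>ln K0\<bar> * (1 + (A + W))"
        using A0 W0 mult_left_mono[of 1 "1 + (A + W)" "\<bar>ln K0\<bar>"] by simp
      moreover have "C * (1 + A) + W \<le> (C + 1) * (1 + (A + W))"
        using C A0 W0 mult_nonneg_nonneg[OF C W0] by (simp add: algebra_simps)
      then have "K * (C * (1 + A) + W) \<le> K * ((C + 1) * (1 + (A + W)))" using K by (intro mult_left_mono) auto
      ultimately have "ln K0 + K * (C * (1 + A) + W) \<le> CC * (1 + (A + W))"
        unfolding CC_def by (simp only: distrib_right mult.assoc)
      then show ?thesis by simp
    qed
    \<comment> \<open>The gauge integral over the closed interval equals the Lebesgue integral over
      the open one.\<close>
    also have "A = 1 / l ^ (k - 1) * (LINT x:{0<..<T}|lebesgue. \<bar>higher_deriv_on {0..T} k \<gamma> x\<bar>)"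
    proof -
      have "(\<lambda>x. \<bar>g k x\<bar>) absolutely_integrable_on {0..T}"
        using cont by (intro absolutely_integrable_continuous_real continuous_intros)
      then have "(\<lambda>x. \<bar>g k x\<bar>) absolutely_integrable_on {0<..<T}"
        by (rule set_integrable_subset) auto
      from set_lebesgue_integral_eq_integral(2)[OF this] show ?thesis
        by (simp add: A_def g_def integral_open_interval_real)
    qed
    finally show "energy l T u t \<le> exp (CC * (1 +
               (1 / l ^ (k - 1) * (LINT x:{0<..<T}|lebesgue. \<bar>higher_deriv_on {0..T} k \<gamma> x\<bar>) +
                l * (LINT x:{0<..<T}|lebesgue. \<bar>\<gamma> x - 1 / c x\<bar>))))"
      unfolding W_def .
  qed
qed

section \<open>Passage to the supremum and the infimum\<close>

lemma ereal_log_le: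
  assumes "x \<le> ereal (exp b)"
  shows "ereal_log x \<le> ereal b"
proof (cases x)
  case (real r)
  then show ?thesis using assms ln_le_cancel_iff[of r "exp b"] by (simp add: ereal_log_def)
qed (use assms in \<open>auto simp: ereal_log_def\<close>)

text \<open>A finite \<open>x\<close> can be solved for \<open>f s\<close>, giving a lower bound
  independent of \<open>s\<close>. Nonemptiness of \<open>S\<close> excludes
  \<open>x = \<infinity>\<close>.\<close>

lemma le_cINF_affine:
  fixes f :: "'a \<Rightarrow> real"
  assumes "S \<noteq> {}" and "0 < C" and le: "\<And>s. s \<in> S \<Longrightarrow> x \<le> ereal (C * (1 + f s))"
  shows "x \<le> ereal (C * (1 + (INF s\<in>S. f s)))"
proof (cases x)
  case (real r)
  have "r / C - 1 \<le> (INF s\<in>S. f s)"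
    using assms(1)
  proof (rule cINF_greatest)
    fix s assume "s \<in> S"
    then show "r / C - 1 \<le> f s" using le[of s] real \<open>0 < C\<close> by (simp add: field_simps)
  qed
  then show ?thesis using real \<open>0 < C\<close> by (simp add: field_simps)
qed (use assms in auto)

theorem theorem6p1:
  fixes T \<nu>1 \<nu>2 :: real and k :: nat
  assumes "0 < T" and "0 < \<nu>1" and "0 < \<nu>2" and "\<nu>1 \<le> \<nu>2" and "1 \<le> k"
  shows "\<exists>\<epsilon>>0. \<exists>C>0. \<forall>c :: real \<Rightarrow> real.
           c \<in> borel_measurable (lebesgue_on {0<..<T}) \<longrightarrow>
           (AE t in lebesgue_on {0<..<T}. \<nu>1 \<le> c t \<and> c t \<le> \<nu>2) \<longrightarrow>
           (\<forall>l>0. growth c l T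
              \<le> ereal (C * (1 + constrained_min (1 / \<nu>2) (1 / \<nu>1) \<epsilon> k T (\<lambda>t. 1 / c t) l)))"
proof -
  obtain \<epsilon> C where \<epsilon>: "\<epsilon> > 0" and C: "C > 0" and bd: "\<forall>T>0. \<forall>c \<in> borel_measurable (lebesgue_on {0<..<T}).
           (AE t in lebesgue_on {0<..<T}. \<nu>1 \<le> c t \<and> c t \<le> \<nu>2) \<longrightarrow>
           (\<forall>l>0. \<forall>\<gamma>\<in>admissible (1 / \<nu>2) (1 / \<nu>1) \<epsilon> k T l. \<forall>u. \<forall>t\<in>{0..T}.
             wave_solution c l T u \<longrightarrow> energy l T u 0 \<le> 1 \<longrightarrow>
             energy l T u t \<le> exp (C * (1 +
               (1 / l ^ (k - 1) * (LINT x:{0<..<T}|lebesgue. \<bar>higher_deriv_on {0..T} k \<gamma> x\<bar>) +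
                l * (LINT x:{0<..<T}|lebesgue. \<bar>\<gamma> x - 1 / c x\<bar>)))))"
    using energy_admissible_bound[OF assms(2,4,5)] by (elim exE conjE that)
  show ?thesis
  proof (rule exI[of _ \<epsilon>], rule conjI[OF \<epsilon>], rule exI[of _ C], rule conjI[OF C], intro allI impI)
    fix c :: "real \<Rightarrow> real" and l :: real
    assume c: "c \<in> borel_measurable (lebesgue_on {0<..<T})"
      and cb: "AE t in lebesgue_on {0<..<T}. \<nu>1 \<le> c t \<and> c t \<le> \<nu>2" and l: "0 < l"
    show "growth c l T \<le> ereal (C * (1 + constrained_min (1 / \<nu>2) (1 / \<nu>1) \<epsilon> k T (\<lambda>t. 1 / c t) l))"
      unfolding constrained_min_def
    proof (rule le_cINF_affine[OF _ C])
      have "(\<lambda>x. 1 / \<nu>2) \<in> admissible (1 / \<nu>2) (1 / \<nu>1) \<epsilon> k T l"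
        using assms \<epsilon> l by (intro const_admissible) (auto simp: frac_le)
      then show "admissible (1 / \<nu>2) (1 / \<nu>1) \<epsilon> k T l \<noteq> {}" by blast
      fix \<gamma> assume \<gamma>: "\<gamma> \<in> admissible (1 / \<nu>2) (1 / \<nu>1) \<epsilon> k T l"
      show "growth c l T \<le> ereal (C * (1 +
               (1 / l ^ (k - 1) * (LINT x:{0<..<T}|lebesgue. \<bar>higher_deriv_on {0..T} k \<gamma> x\<bar>) +
                l * (LINT x:{0<..<T}|lebesgue. \<bar>\<gamma> x - 1 / c x\<bar>))))"
        unfolding growth_def
      proof (rule ereal_log_le, rule Sup_least)
        fix y assume "y \<in> {ereal (energy l T u t) | u t.
                       wave_solution c l T u \<and> energy l T u 0 \<le> 1 \<and> t \<in> {0..T}}"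
        then obtain u t where y: "y = ereal (energy l T u t)" and u: "wave_solution c l T u"
          "energy l T u 0 \<le> 1" "t \<in> {0..T}" by blast
        show "y \<le> ereal (exp (C * (1 +
               (1 / l ^ (k - 1) * (LINT x:{0<..<T}|lebesgue. \<bar>higher_deriv_on {0..T} k \<gamma> x\<bar>) +
                l * (LINT x:{0<..<T}|lebesgue. \<bar>\<gamma> x - 1 / c x\<bar>)))))"
          using bd[rule_format, OF assms(1) c cb l \<gamma> u(3,1,2)] unfolding y by simp
      qed
    qed
  qed
qed

end
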